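(* Let $\{\phi_j\}_{j}$ be a (finite or countably infinite) orthonormal system of complex-valued functions on a probability space $(\Omega,\mu)$ which is uniformly bounded ($\sup_j \|\phi_j\|_{L^\infty} < \infty$) and satisfies the $\psi_2(C)$ condition for some $C<\infty$. Then the orthonormal system on the product probability space $(\Omega^5,\mu^{\otimes 5})$ obtained as the five-fold tensor $$\Phi_j := \phi_j\otimes\phi_j\otimes\phi_j\otimes\phi_j\otimes\phi_j,\qquad \Phi_j(x_1,\ldots,x_5)=\prod_{s=1}^5 \phi_j(x_s),$$ is Sidon.
   Context: For a measurable function $f$ on a probability space, $\|f\|_{\psi_2} = \inf\{t>0 : \int (e^{|f|^2/t^2}-1)\,d\mu \leq 1\}$. A system $\{\phi_j\}$ satisfies the $\psi_2(C)$ condition if $\|\sum_j a_j\phi_j\|_{\psi_2} \leq C\left(\sum_j |a_j|^2\right)^{1/2}$ for all complex scalars $a_j$ (finitely many nonzero). A uniformly bounded orthonormal system $\{\phi_j\}$ on a probability space $\Omega$ is Sidon if there is a constant $\gamma>0$ such that $\sup_{x\in\Omega}|\sum_j a_j\phi_j(x)| \geq \gamma\sum_j |a_j|$ for all complex numbers $a_j$ (finitely many nonzero). *)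

theory Defs
  imports "HOL-Probability.Probability"
begin

text \<open>Systems of functions are families \<open>\<phi>\<close> restricted to an index set \<open>J\<close>; a coefficient family
  with finitely many nonzero entries is a finite \<open>F \<subseteq> J\<close> together with \<open>a\<close>, summed over \<open>F\<close>.
  All norms and suprema below take values in \<^typ>\<open>ennreal\<close>, so that they may be infinite.\<close>

definition orthonormal_system :: "'a measure \<Rightarrow> 'i set \<Rightarrow> ('i \<Rightarrow> 'a \<Rightarrow> complex) \<Rightarrow> bool" where
  "orthonormal_system M J \<phi> \<longleftrightarrow>
     (\<forall>j\<in>J. \<phi> j \<in> borel_measurable M \<and> integrable M (\<lambda>x. (cmod (\<phi> j x))\<^sup>2)) \<and>
     (\<forall>i\<in>J. \<forall>j\<in>J. (LINT x|M. \<phi> i x * cnj (\<phi> j x)) = (if i = j then 1 else 0))"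

definition uniformly_bounded_system :: "'a measure \<Rightarrow> 'i set \<Rightarrow> ('i \<Rightarrow> 'a \<Rightarrow> complex) \<Rightarrow> bool" where
  "uniformly_bounded_system M J \<phi> \<longleftrightarrow>
     (SUP j\<in>J. esssup M (\<lambda>x. ennreal (cmod (\<phi> j x)))) < \<infinity>"

definition psi2_norm :: "'a measure \<Rightarrow> ('a \<Rightarrow> complex) \<Rightarrow> ennreal" where
  "psi2_norm M f =
     Inf {ennreal t | t. t > 0 \<and> (\<integral>\<^sup>+x. ennreal (exp ((cmod (f x))\<^sup>2 / t\<^sup>2) - 1) \<partial>M) \<le> 1}"

definition psi2_condition :: "real \<Rightarrow> 'a measure \<Rightarrow> 'i set \<Rightarrow> ('i \<Rightarrow> 'a \<Rightarrow> complex) \<Rightarrow> bool" where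
  "psi2_condition C M J \<phi> \<longleftrightarrow>
     (\<forall>F a. finite F \<and> F \<subseteq> J \<longrightarrow>
        psi2_norm M (\<lambda>x. \<Sum>j\<in>F. a j * \<phi> j x) \<le> ennreal (C * sqrt (\<Sum>j\<in>F. (cmod (a j))\<^sup>2)))"

text \<open>The supremum here is the pointwise one over the whole space, not the essential supremum.\<close>

definition sidon_system :: "'a measure \<Rightarrow> 'i set \<Rightarrow> ('i \<Rightarrow> 'a \<Rightarrow> complex) \<Rightarrow> bool" where
  "sidon_system M J \<phi> \<longleftrightarrow>
     orthonormal_system M J \<phi> \<and> uniformly_bounded_system M J \<phi> \<and>
     (\<exists>\<gamma>>0. \<forall>F a. finite F \<and> F \<subseteq> J \<longrightarrow>
        (SUP x\<in>space M. ennreal (cmod (\<Sum>j\<in>F. a j * \<phi> j x))) \<ge> ennreal (\<gamma> * (\<Sum>j\<in>F. cmod (a j))))"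

text \<open>Points of the \<open>n\<close>-fold product space are functions on \<open>{1..n}\<close>.\<close>

definition power_measure :: "nat \<Rightarrow> 'a measure \<Rightarrow> (nat \<Rightarrow> 'a) measure" where
  "power_measure n M = (\<Pi>\<^sub>M s\<in>{1..n}. M)"

definition tensor_power :: "nat \<Rightarrow> ('a \<Rightarrow> complex) \<Rightarrow> (nat \<Rightarrow> 'a) \<Rightarrow> complex" where
  "tensor_power n f x = (\<Prod>s=1..n. f (x s))"

end

theory Submission
  imports Defs
begin

text \<open>
  The proof bounds \<open>\<Sum>j. \<bar>a j\<bar>\<close> already by the supremum of
  \<open>\<bar>\<Sum>j. a j * \<phi> j x * \<phi> j y * \<phi> j z\<bar>\<close> over three variables. In the fivefold sum the two remaining
  variables are set equal to a point \<open>p\<close>; this replaces \<open>a j\<close> by \<open>a j * (\<phi> j p)\<^sup>2\<close>, and integrating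
  over \<open>p\<close> restores \<open>\<bar>a j\<bar>\<close> because \<open>\<phi> j\<close> has norm \<open>1\<close>. Three ideas give the threefold bound.

  \<^bold>\<open>Duality.\<close> Let \<open>r\<close> and \<open>r'\<close> be independent uniform sign vectors indexed by a finite set \<open>U\<close>, and choose
  a point \<open>X r\<close> of the space for each \<open>r\<close>. The Riesz product
  \<open>\<Prod>i\<in>U. 1 + \<delta> * Re (\<omega> i * cnj (\<phi> i z)) * r i * r' i\<close> is nonnegative for small \<open>\<delta>\<close> and has mean \<open>1\<close>, so
  averaging \<open>\<Sum>j. a j * \<phi> j (X r) * \<phi> j (X r') * \<phi> j z\<close> against it gives at most the supremum. Expand
  the product. The coefficient of \<open>\<phi> j\<close> at a Walsh function enters squared, once from \<open>r\<close> and once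
  from \<open>r'\<close>. In the terms of first order the integral over \<open>z\<close> kills all pairs \<open>i \<noteq> j\<close> and leaves
  \<open>\<delta> * a j * \<omega> j * (u j)\<^sup>2\<close> with \<open>u j = E (r j * \<phi> j (X r))\<close>; by Parseval on the cube the terms of higher
  order are \<open>O(\<delta>\<^sup>2)\<close>, uniformly in \<open>j\<close>; and the term of order zero, being the average for \<open>\<delta> = 0\<close>, is itself
  at most the supremum. For suitable phases \<open>\<omega> j\<close> the supremum therefore controls
  \<open>\<delta> * (\<Sum>j\<in>U. \<bar>a j\<bar> * \<bar>u j\<bar>\<^sup>2) - O(\<delta>\<^sup>2) * (\<Sum>j. \<bar>a j\<bar>)\<close> (\<open>diagonal_coefficients\<close>). It remains to find \<open>X\<close>
  for which the \<open>u j\<close> are not small on average; this is a statement about the expected supremum of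
  a randomly signed sum, and only there the \<open>\<psi>\<^sub>2\<close> condition is used.

  \<^bold>\<open>One block.\<close> Pass to real parts \<open>h j\<close> (after a rotation of \<open>\<phi> j\<close>). For \<open>n\<close> functions with equal weights
  and a set \<open>A\<close> on which \<open>\<Sum>j. (h j)\<^sup>2 \<ge> n / 4\<close>, consider
  \<open>Z r = \<integral>\<^sub>A \<Prod>j. 1 + \<delta> * r j * h j\<close>. Its mean is the measure of \<open>A\<close>, and by subgaussianity its second
  moment exceeds the measure of \<open>A\<close> by a factor \<open>exp (O(\<delta>\<^sup>4 n))\<close> at most. If \<open>A\<close> itself is not smaller than
  \<open>exp (- O(\<delta>\<^sup>4 n))\<close>, then neither is the probability that \<open>Z\<close> is at least half its mean, and in that
  case \<open>ln (\<integral>\<^sub>A exp (\<delta> * (\<Sum>j. r j * h j)))\<close> is at least of order \<open>\<delta>\<^sup>2 n\<close>.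
  One flipped sign changes this logarithm by \<open>O(\<delta>)\<close>, so it is concentrated around its mean: on events of
  probability \<open>exp (- O(\<delta>\<^sup>4 n))\<close> it deviates from the mean by \<open>O(\<delta>\<^sup>3 n)\<close> only. So the mean itself is of order
  \<open>\<delta>\<^sup>2 n\<close>, which means that with probability bounded below \<open>\<Sum>j. r j * h j\<close> is of order \<open>n\<close> on a subset of \<open>A\<close>
  whose measure is at least \<open>exp (- O(n))\<close> (\<open>many_signs_large_rsum\<close>).

  \<^bold>\<open>Many blocks.\<close> Sorting the weights and cutting at geometrically growing positions replaces them,
  up to constants and a multiple of the largest weight, by weights that are constant on blocks whose
  sizes grow at least by a large factor \<open>L\<close> (\<open>lacunary_blocks\<close>). The blocks are treated from the smallest to the
  largest, each inside the set \<open>A\<close> produced before. The measure \<open>exp (- O(n))\<close> of that set is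
  harmless for the next block, whose size is at least \<open>L * n\<close> (\<open>lacunary_chain\<close>).
\<close>

section \<open>Averages over the sign cube\<close>

text \<open>A sign vector is encoded by the set of coordinates at which it is \<open>+ 1\<close>.\<close>

definition cube_mean :: "'i set \<Rightarrow> ('i set \<Rightarrow> 'b) \<Rightarrow> 'b::real_normed_field" where
  "cube_mean I g = (\<Sum>S\<in>Pow I. g S) / 2 ^ card I"

definition sgn_at :: "'i set \<Rightarrow> 'i \<Rightarrow> real" where
  "sgn_at S i = (if i \<in> S then 1 else - 1)"

lemma sgn_at_simps [simp]: "\<bar>sgn_at S i\<bar> = 1" "sgn_at S i * sgn_at S i = 1"
  by (auto simp: sgn_at_def)

lemma cube_mean_empty [simp]: "cube_mean {} g = g {}"
  by (simp add: cube_mean_def)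

lemma cube_mean_cong:
  "(\<And>S. S \<subseteq> I \<Longrightarrow> f S = g S) \<Longrightarrow> cube_mean I f = cube_mean I g"
  unfolding cube_mean_def by (intro arg_cong2[where f = "(/)"] sum.cong) auto

lemma cube_mean_mono:
  fixes f g :: "'i set \<Rightarrow> real"
  shows "(\<And>S. S \<subseteq> I \<Longrightarrow> f S \<le> g S) \<Longrightarrow> cube_mean I f \<le> cube_mean I g"
  unfolding cube_mean_def by (intro divide_right_mono sum_mono) auto

lemma cube_mean_const [simp]: "finite I \<Longrightarrow> cube_mean I (\<lambda>_. c) = c"
  by (simp add: cube_mean_def card_Pow)

lemma cube_mean_add: "cube_mean I (\<lambda>S. f S + g S) = cube_mean I f + cube_mean I g"
  by (simp add: cube_mean_def sum.distrib add_divide_distrib)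

lemma cube_mean_diff: "cube_mean I (\<lambda>S. f S - g S) = cube_mean I f - cube_mean I g"
  by (simp add: cube_mean_def sum_subtractf diff_divide_distrib)

lemma cube_mean_cmult: "cube_mean I (\<lambda>S. c * f S) = c * cube_mean I f"
  by (simp add: cube_mean_def sum_distrib_left)

lemma cube_mean_sum: "cube_mean I (\<lambda>S. \<Sum>k\<in>K. f k S) = (\<Sum>k\<in>K. cube_mean I (f k))"
  unfolding cube_mean_def by (subst sum.swap) (simp add: sum_divide_distrib)

lemma Re_cube_mean: "Re (cube_mean I f) = cube_mean I (\<lambda>S. Re (f S))"
proof -
  have two: "(2::complex) ^ card I = of_real (2 ^ card I)" by simp
  show ?thesis
    unfolding cube_mean_def two by (simp only: Re_divide_of_real Re_sum)
qed

lemma norm_cube_mean_le: "norm (cube_mean I f) \<le> cube_mean I (\<lambda>S. norm (f S))"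
  by (simp add: cube_mean_def norm_divide norm_power divide_right_mono norm_sum)

lemma sum_Pow_Un:
  assumes "A \<inter> B = {}"
  shows "(\<Sum>S\<in>Pow (A \<union> B). g S) = (\<Sum>S\<in>Pow A. \<Sum>T\<in>Pow B. g (S \<union> T))"
proof -
  have "(\<Sum>S\<in>Pow (A \<union> B). g S) = (\<Sum>(S, T)\<in>Pow A \<times> Pow B. g (S \<union> T))"
    by (rule sum.reindex_bij_witness[where i = "\<lambda>(S, T). S \<union> T" and j = "\<lambda>S. (S \<inter> A, S \<inter> B)"])
       (use assms in \<open>auto intro: arg_cong[where f = g]\<close>)
  then show ?thesis
    by (simp add: sum.cartesian_product)
qed

lemma cube_mean_Un:
  assumes "A \<inter> B = {}" "finite A" "finite B"
  shows "cube_mean (A \<union> B) g = cube_mean A (\<lambda>S. cube_mean B (\<lambda>T. g (S \<union> T)))"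
  unfolding cube_mean_def using assms
  by (simp add: sum_Pow_Un card_Un_disjoint power_add sum_divide_distrib mult.commute)

lemma cube_mean_insert:
  assumes "finite I" "i \<notin> I"
  shows "cube_mean (insert i I) g = cube_mean I (\<lambda>S. (g S + g (insert i S)) / 2)"
proof -
  have "cube_mean (I \<union> {i}) g = cube_mean I (\<lambda>S. cube_mean {i} (\<lambda>T. g (S \<union> T)))"
    using assms by (intro cube_mean_Un) auto
  also have "\<dots> = cube_mean I (\<lambda>S. (g S + g (insert i S)) / 2)"
    by (simp add: cube_mean_def Pow_insert add.commute)
  finally show ?thesis by simp
qed

lemma cube_mean_prod:
  fixes p :: "'i \<Rightarrow> real \<Rightarrow> 'b::real_normed_field"
  assumes "finite I"
  shows "cube_mean I (\<lambda>S. \<Prod>i\<in>I. p i (sgn_at S i)) = (\<Prod>i\<in>I. (p i 1 + p i (- 1)) / 2)"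
proof -
  have "(\<Prod>i\<in>I. p i 1 + p i (- 1)) = (\<Sum>S\<in>Pow I. (\<Prod>i\<in>S. p i 1) * (\<Prod>i\<in>I - S. p i (- 1)))"
    by (rule prod_add[OF assms])
  also have "\<dots> = (\<Sum>S\<in>Pow I. \<Prod>i\<in>I. p i (sgn_at S i))"
  proof (intro sum.cong refl)
    fix S assume "S \<in> Pow I"
    then have S: "S \<subseteq> I" by simp
    have "(\<Prod>i\<in>I. p i (sgn_at S i)) = (\<Prod>i\<in>I - S. p i (sgn_at S i)) * (\<Prod>i\<in>S. p i (sgn_at S i))"
      by (rule prod.subset_diff[OF S assms])
    then show "(\<Prod>i\<in>S. p i 1) * (\<Prod>i\<in>I - S. p i (- 1)) = (\<Prod>i\<in>I. p i (sgn_at S i))"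
      by (simp add: sgn_at_def mult.commute)
  qed
  finally show ?thesis
    by (simp add: cube_mean_def prod_dividef)
qed

text \<open>Concentration on the cube, as a bound for the exponential moment. Averaging out one coordinate
  preserves the Lipschitz condition in the others, and Hoeffding's lemma for a two-point distribution
  bounds what each coordinate contributes.\<close>

lemma cube_mean_exp_le:
  fixes G :: "'i set \<Rightarrow> real"
  assumes "finite I"
    and "\<And>S i. i \<in> I \<Longrightarrow> S \<subseteq> I - {i} \<Longrightarrow> \<bar>G (insert i S) - G S\<bar> \<le> 2 * d"
  shows "cube_mean I (\<lambda>S. exp (l * G S)) \<le> exp (l * cube_mean I G + l\<^sup>2 * d\<^sup>2 * card I / 2)"
  using assms
proof (induction I arbitrary: G rule: finite_induct)
  case (insert i I)
  have pair: "(exp (l * u) + exp (l * v)) / 2 \<le> exp (l\<^sup>2 * d\<^sup>2 / 2) * exp (l * ((u + v) / 2))"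
    if uv: "\<bar>v - u\<bar> \<le> 2 * d" for u v :: real
  proof -
    have *: "(exp x + exp y) / 2 \<le> exp ((x + y) / 2 + (x - y)\<^sup>2 / 8)" if "x \<le> y" for x y :: real
    proof -
      have "ln (1 + 1 / 2 * (exp (y - x) - 1)) \<le> (y - x) / 2 + (y - x)\<^sup>2 / 8"
        using Hoeffdings_lemma_aux[of "y - x" "1/2"] that by linarith
      moreover have "1 + 1 / 2 * (exp (y - x) - 1) > 0"
        using exp_gt_zero[of "y - x"] by (simp add: field_simps add_pos_pos del: exp_gt_zero)
      ultimately have "1 + 1 / 2 * (exp (y - x) - 1) \<le> exp ((y - x) / 2 + (y - x)\<^sup>2 / 8)"
        by (metis exp_ln exp_le_cancel_iff)
      then have "exp x * (1 + 1 / 2 * (exp (y - x) - 1)) \<le> exp x * exp ((y - x) / 2 + (y - x)\<^sup>2 / 8)"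
        by (intro mult_left_mono) auto
      then show ?thesis
        by (simp add: algebra_simps flip: exp_add) (simp add: field_simps power2_eq_square)
    qed
    have "(l * u - l * v)\<^sup>2 \<le> l\<^sup>2 * (2 * d)\<^sup>2"
      using power_mono[OF uv, of 2]
      by (simp add: power_mult_distrib power2_commute flip: right_diff_distrib) (simp add: mult_left_mono)
    then have q: "(l * u - l * v)\<^sup>2 / 8 \<le> l\<^sup>2 * d\<^sup>2 / 2"
      by (simp add: power_mult_distrib)
    have "(exp (l * u) + exp (l * v)) / 2 \<le> exp ((l * u + l * v) / 2 + (l * u - l * v)\<^sup>2 / 8)"
      using *[of "l * u" "l * v"] *[of "l * v" "l * u"]
      by (cases "l * u \<le> l * v") (auto simp: add.commute power2_commute)
    also have "\<dots> \<le> exp ((l * u + l * v) / 2 + l\<^sup>2 * d\<^sup>2 / 2)"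
      using q by simp
    finally show ?thesis
      by (simp add: algebra_simps flip: exp_add)
  qed
  define G' where "G' S = (G S + G (insert i S)) / 2" for S
  have IH: "cube_mean I (\<lambda>S. exp (l * G' S)) \<le> exp (l * cube_mean I G' + l\<^sup>2 * d\<^sup>2 * card I / 2)"
  proof (rule insert.IH)
    fix S k assume k: "k \<in> I" and S: "S \<subseteq> I - {k}"
    have "\<bar>G (insert k S) - G S\<bar> \<le> 2 * d"
      using k S by (intro insert.prems) auto
    moreover have "\<bar>G (insert k (insert i S)) - G (insert i S)\<bar> \<le> 2 * d"
      using k S insert.hyps by (intro insert.prems) auto
    ultimately show "\<bar>G' (insert k S) - G' S\<bar> \<le> 2 * d"
      unfolding G'_def by (simp add: insert_commute[of i k] abs_le_iff field_simps)
  qed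
  have "cube_mean (insert i I) (\<lambda>S. exp (l * G S))
      = cube_mean I (\<lambda>S. (exp (l * G S) + exp (l * G (insert i S))) / 2)"
    using insert.hyps by (rule cube_mean_insert)
  also have "\<dots> \<le> cube_mean I (\<lambda>S. exp (l\<^sup>2 * d\<^sup>2 / 2) * exp (l * G' S))"
    unfolding G'_def using insert.hyps by (intro cube_mean_mono pair insert.prems) auto
  also have "\<dots> \<le> exp (l\<^sup>2 * d\<^sup>2 / 2) * exp (l * cube_mean I G' + l\<^sup>2 * d\<^sup>2 * card I / 2)"
    unfolding cube_mean_cmult using IH by (intro mult_left_mono) auto
  also have "\<dots> = exp (l * cube_mean (insert i I) G + l\<^sup>2 * d\<^sup>2 * card (insert i I) / 2)"
    using insert.hyps unfolding G'_def
    by (simp add: cube_mean_insert algebra_simps add_divide_distrib flip: exp_add)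
  finally show ?case .
qed simp

definition walsh :: "'i set \<Rightarrow> 'i set \<Rightarrow> real" where
  "walsh S T = (\<Prod>i\<in>S. sgn_at T i)"

text \<open>Both facts below rest on multiplying out a product over \<open>U\<close> into its sum over subsets. For Parseval
  it shows that \<open>\<Sum>S. walsh S T * walsh S T'\<close> is \<open>\<Prod>i. 1 + r i * r' i\<close>, which vanishes unless \<open>T = T'\<close>.\<close>

lemma walsh_parseval:
  fixes g :: "'i set \<Rightarrow> complex"
  assumes "finite U"
  shows "(\<Sum>S\<in>Pow U. (cmod (cube_mean U (\<lambda>T. of_real (walsh S T) * g T)))\<^sup>2)
    = cube_mean U (\<lambda>T. (cmod (g T))\<^sup>2)"
proof -
  have ker: "(\<Sum>S\<in>Pow U. walsh S T * walsh S T') = (if T = T' then 2 ^ card U else 0)"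
    if sub: "T \<in> Pow U" "T' \<in> Pow U" for T T'
  proof -
    have "(\<Sum>S\<in>Pow U. walsh S T * walsh S T') = (\<Prod>i\<in>U. sgn_at T i * sgn_at T' i + 1)"
      using prod_add[OF assms, of "\<lambda>i. sgn_at T i * sgn_at T' i" "\<lambda>_. 1"]
      by (simp add: walsh_def prod.distrib)
    also have "\<dots> = (if T = T' then 2 ^ card U else 0)"
    proof (cases "T = T'")
      case False
      then obtain i where "i \<in> U" "(i \<in> T) \<noteq> (i \<in> T')"
        using sub by auto
      then have "(\<Prod>i\<in>U. sgn_at T i * sgn_at T' i + 1) = 0"
        using assms by (intro prod_zero) (auto simp: sgn_at_def)
      with False show ?thesis by simp
    qed simp
    finally show ?thesis .
  qed
  have "complex_of_real (\<Sum>S\<in>Pow U. (cmod (cube_mean U (\<lambda>T. of_real (walsh S T) * g T)))\<^sup>2)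
      = (\<Sum>S\<in>Pow U. (\<Sum>T\<in>Pow U. \<Sum>T'\<in>Pow U.
           of_real (walsh S T * walsh S T') * (g T * cnj (g T'))) / (2 ^ card U * 2 ^ card U))"
  proof (unfold of_real_sum, intro sum.cong refl)
    fix S
    have "complex_of_real ((cmod (cube_mean U (\<lambda>T. of_real (walsh S T) * g T)))\<^sup>2)
        = (\<Sum>T\<in>Pow U. of_real (walsh S T) * g T) * (\<Sum>T'\<in>Pow U. of_real (walsh S T') * cnj (g T'))
          / (2 ^ card U * 2 ^ card U)"
      unfolding complex_norm_square by (simp add: cube_mean_def)
    then show "complex_of_real ((cmod (cube_mean U (\<lambda>T. of_real (walsh S T) * g T)))\<^sup>2)
        = (\<Sum>T\<in>Pow U. \<Sum>T'\<in>Pow U. of_real (walsh S T * walsh S T') * (g T * cnj (g T')))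
          / (2 ^ card U * 2 ^ card U)"
      unfolding sum_product by (simp add: algebra_simps)
  qed
  also have "\<dots> = (\<Sum>T\<in>Pow U. \<Sum>T'\<in>Pow U.
      of_real (\<Sum>S\<in>Pow U. walsh S T * walsh S T') * (g T * cnj (g T'))) / (2 ^ card U * 2 ^ card U)"
  proof -
    let ?F = "\<lambda>S T T'. complex_of_real (walsh S T * walsh S T') * (g T * cnj (g T'))"
    have "(\<Sum>S\<in>Pow U. \<Sum>T\<in>Pow U. \<Sum>T'\<in>Pow U. ?F S T T')
        = (\<Sum>T\<in>Pow U. \<Sum>S\<in>Pow U. \<Sum>T'\<in>Pow U. ?F S T T')"
      by (rule sum.swap)
    also have "\<dots> = (\<Sum>T\<in>Pow U. \<Sum>T'\<in>Pow U. \<Sum>S\<in>Pow U. ?F S T T')"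
      by (intro sum.cong refl sum.swap)
    finally show ?thesis
      by (simp add: sum_distrib_right flip: sum_divide_distrib)
  qed
  also have "\<dots> = (\<Sum>T\<in>Pow U. \<Sum>T'\<in>Pow U.
      if T = T' then 2 ^ card U * (g T * cnj (g T)) else 0) / (2 ^ card U * 2 ^ card U)"
    by (intro arg_cong2[where f = "(/)"] sum.cong refl) (simp add: ker)
  also have "\<dots> = of_real (cube_mean U (\<lambda>T. (cmod (g T))\<^sup>2))"
    using assms
    by (simp add: cube_mean_def flip: sum_distrib_left complex_norm_square)
  finally show ?thesis
    using of_real_eq_iff by blast
qed

text \<open>Since the kernel couples the two sign vectors only through the products \<open>r i * r' i\<close>, it is diagonal
  in the Walsh basis and squares the coefficients of \<open>g\<close>.\<close>

lemma riesz_product_walsh_expansion: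
  fixes g :: "'i set \<Rightarrow> complex" and c :: "'i \<Rightarrow> real"
  assumes "finite U"
  shows "cube_mean U (\<lambda>T. cube_mean U (\<lambda>T'.
      of_real (\<Prod>i\<in>U. 1 + c i * (sgn_at T i * sgn_at T' i)) * (g T * g T')))
    = (\<Sum>S\<in>Pow U. of_real (\<Prod>i\<in>S. c i) * (cube_mean U (\<lambda>T. of_real (walsh S T) * g T))\<^sup>2)"
proof -
  have expand: "(\<Prod>i\<in>U. 1 + c i * (sgn_at T i * sgn_at T' i))
      = (\<Sum>S\<in>Pow U. (\<Prod>i\<in>S. c i) * (walsh S T * walsh S T'))" for T T'
    using prod_add[OF assms, of "\<lambda>i. c i * (sgn_at T i * sgn_at T' i)" "\<lambda>_. 1"]
    by (simp add: walsh_def prod.distrib add.commute)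
  have "cube_mean U (\<lambda>T. cube_mean U (\<lambda>T'.
      of_real (\<Prod>i\<in>U. 1 + c i * (sgn_at T i * sgn_at T' i)) * (g T * g T')))
    = cube_mean U (\<lambda>T. \<Sum>S\<in>Pow U. (of_real (\<Prod>i\<in>S. c i) * (of_real (walsh S T) * g T)) * cube_mean U (\<lambda>T'.
       of_real (walsh S T') * g T'))"
    unfolding expand of_real_sum sum_distrib_right
    by (simp only: cube_mean_sum flip: cube_mean_cmult) (simp add: algebra_simps)
  also have "\<dots> = (\<Sum>S\<in>Pow U. of_real (\<Prod>i\<in>S. c i) * (cube_mean U (\<lambda>T. of_real (walsh S T) * g T))\<^sup>2)"
    unfolding cube_mean_sum
  proof (intro sum.cong refl)
    fix S
    define K where "K = cube_mean U (\<lambda>T. of_real (walsh S T) * g T)"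
    have "cube_mean U (\<lambda>T. (of_real (\<Prod>i\<in>S. c i) * (of_real (walsh S T) * g T)) * K)
        = cube_mean U (\<lambda>T. (of_real (\<Prod>i\<in>S. c i) * K) * (of_real (walsh S T) * g T))"
      by (simp add: algebra_simps)
    then show "cube_mean U (\<lambda>T. (of_real (\<Prod>i\<in>S. c i) * (of_real (walsh S T) * g T)) *
          cube_mean U (\<lambda>T'. of_real (walsh S T') * g T'))
        = of_real (\<Prod>i\<in>S. c i) * (cube_mean U (\<lambda>T. of_real (walsh S T) * g T))\<^sup>2"
      unfolding cube_mean_cmult K_def by (simp add: power2_eq_square)
  qed
  finally show ?thesis .
qed

section \<open>Random signs on one block of subgaussian functions\<close>

text \<open>The quadratic gain over \<open>1 + t \<le> exp t\<close> is what makes a Riesz product of mean \<open>1\<close> force the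
  exponential of the sum to be large.\<close>

lemma one_plus_le_exp_minus_square:
  fixes t :: real
  assumes "\<bar>t\<bar> \<le> 1 / 2"
  shows "1 + t \<le> exp (t - t\<^sup>2 / 4)"
proof -
  define \<phi> where "\<phi> t = t - t\<^sup>2 / 4 - ln (1 + t)" for t :: real
  have D: "(\<phi> has_real_derivative t * (1 - t) / (2 * (1 + t))) (at t)" if "\<bar>t\<bar> \<le> 1 / 2" for t
    unfolding \<phi>_def using that
    by (auto intro!: derivative_eq_intros simp: field_simps power2_eq_square)
  have "0 \<le> \<phi> t"
  proof (cases "0 \<le> t")
    case True
    have "\<phi> 0 \<le> \<phi> t"
    proof (rule DERIV_nonneg_imp_nondecreasing[OF True])
      fix u assume "0 \<le> u" "u \<le> t"
      then show "\<exists>y. (\<phi> has_real_derivative y) (at u) \<and> 0 \<le> y"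
        using assms by (intro exI[of _ "u * (1 - u) / (2 * (1 + u))"] conjI D) auto
    qed
    then show ?thesis by (simp add: \<phi>_def)
  next
    case False
    then have "t \<le> 0" by simp
    then have "\<phi> 0 \<le> \<phi> t"
    proof (rule DERIV_nonpos_imp_nonincreasing)
      fix u assume "t \<le> u" "u \<le> 0"
      then show "\<exists>y. (\<phi> has_real_derivative y) (at u) \<and> y \<le> 0"
        using assms
        by (intro exI[of _ "u * (1 - u) / (2 * (1 + u))"] conjI D)
           (auto intro!: divide_nonpos_nonneg mult_nonpos_nonneg)
    qed
    then show ?thesis by (simp add: \<phi>_def)
  qed
  then have "ln (1 + t) \<le> t - t\<^sup>2 / 4"
    by (simp add: \<phi>_def)
  moreover have "0 < 1 + t"
    using assms by linarith
  ultimately show ?thesis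
    by (metis exp_ln exp_le_cancel_iff)
qed

text \<open>For real functions the \<open>\<psi>\<^sub>2\<close> condition is used in the following scale-free form, in which \<open>D\<close> plays
  the role of the square of the \<open>\<psi>\<^sub>2\<close> constant and \<open>s\<close> any positive bound for the sum of the squared coefficients.\<close>

locale subgaussian_family = prob_space M for M :: "'a measure" +
  fixes J :: "'i set" and h :: "'i \<Rightarrow> 'a \<Rightarrow> real" and D :: real
  assumes D_pos: "0 < D"
    and h_measurable: "j \<in> J \<Longrightarrow> h j \<in> borel_measurable M"
    and subgaussian: "finite I \<Longrightarrow> I \<subseteq> J \<Longrightarrow> 0 < s \<Longrightarrow> (\<Sum>j\<in>I. (c j)\<^sup>2) \<le> s \<Longrightarrow>
      (\<integral>\<^sup>+x. ennreal (exp ((\<Sum>j\<in>I. c j * h j x)\<^sup>2 / (D * s))) \<partial>M) \<le> 2"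
begin

definition rsum :: "'i set \<Rightarrow> 'i set \<Rightarrow> 'a \<Rightarrow> real" where
  "rsum I S x = (\<Sum>i\<in>I. sgn_at S i * h i x)"

lemma rsum_measurable:
  assumes "I \<subseteq> J" shows "rsum I S \<in> borel_measurable M"
  unfolding rsum_def
  by (intro borel_measurable_sum borel_measurable_times borel_measurable_const h_measurable)
     (use assms in auto)

lemma rsum_cong:
  "(\<And>i. i \<in> I \<Longrightarrow> i \<in> S \<longleftrightarrow> i \<in> T) \<Longrightarrow> rsum I S = rsum I T"
  by (auto simp: rsum_def sgn_at_def fun_eq_iff intro!: sum.cong)

lemma rsum_tail:
  fixes \<epsilon> :: real
  assumes I: "finite I" "I \<subseteq> J" "I \<noteq> {}" and "0 \<le> \<epsilon>"
  shows "prob {x \<in> space M. \<epsilon> * card I < \<bar>rsum I S x\<bar>} \<le> 2 * exp (- (\<epsilon>\<^sup>2 * card I / D))"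
proof -
  define n where "n = real (card I)"
  have n: "0 < n" using I by (simp add: n_def card_gt_0_iff)
  note [measurable] = rsum_measurable[OF I(2)]
  define u where "u x = ennreal (exp ((rsum I S x)\<^sup>2 / (D * n)))" for x
  have "(\<Sum>i\<in>I. (sgn_at S i)\<^sup>2) \<le> n"
    by (simp add: n_def power2_eq_square)
  then have int: "(\<integral>\<^sup>+x. u x \<partial>M) \<le> 2"
    unfolding u_def rsum_def by (intro subgaussian I n)
  have "emeasure M {x \<in> space M. \<epsilon> * n < \<bar>rsum I S x\<bar>}
      \<le> emeasure M {x \<in> space M. 1 \<le> ennreal (exp (- (\<epsilon>\<^sup>2 * n / D))) * u x}"
  proof (rule emeasure_mono)
    show "{x \<in> space M. \<epsilon> * n < \<bar>rsum I S x\<bar>} \<subseteq> {x \<in> space M. 1 \<le> ennreal (exp (- (\<epsilon>\<^sup>2 * n / D))) * u x}"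
    proof safe
      fix x assume "\<epsilon> * n < \<bar>rsum I S x\<bar>"
      then have "(\<epsilon> * n)\<^sup>2 \<le> (rsum I S x)\<^sup>2"
        using \<open>0 \<le> \<epsilon>\<close> n by (simp add: abs_le_square_iff[symmetric])
      then have "\<epsilon>\<^sup>2 * n / D \<le> (rsum I S x)\<^sup>2 / (D * n)"
        using n D_pos by (simp add: field_simps power2_eq_square)
      then show "1 \<le> ennreal (exp (- (\<epsilon>\<^sup>2 * n / D))) * u x"
        unfolding u_def by (simp add: ennreal_mult[symmetric] exp_add[symmetric])
    qed
  qed (simp add: u_def)
  also have "\<dots> \<le> ennreal (exp (- (\<epsilon>\<^sup>2 * n / D))) * (\<integral>\<^sup>+x. u x * indicator (space M) x \<partial>M)"
    by (rule order_trans[OF _ nn_integral_Markov_inequality]) (auto simp: u_def)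
  also have "\<dots> \<le> ennreal (exp (- (\<epsilon>\<^sup>2 * n / D))) * 2"
    using int by (intro mult_left_mono) auto
  also have "\<dots> = ennreal (2 * exp (- (\<epsilon>\<^sup>2 * n / D)))"
    by (simp add: ennreal_mult' mult.commute)
  finally show ?thesis
    by (simp add: emeasure_eq_measure n_def)
qed

text \<open>Completing the square: \<open>f \<le> D * s / 4 + f\<^sup>2 / (D * s)\<close>.\<close>

lemma exp_moment:
  assumes I: "finite I" "I \<subseteq> J" and s: "0 < s" "(\<Sum>j\<in>I. (c j)\<^sup>2) \<le> s"
  shows "(\<integral>\<^sup>+x. ennreal (exp (\<Sum>j\<in>I. c j * h j x)) \<partial>M) \<le> ennreal (2 * exp (D * s / 4))"
proof -
  define f where "f x = (\<Sum>j\<in>I. c j * h j x)" for x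
  have [measurable]: "f \<in> borel_measurable M"
    unfolding f_def
    by (intro borel_measurable_sum borel_measurable_times borel_measurable_const h_measurable)
       (use I in auto)
  have "f x \<le> D * s / 4 + (f x)\<^sup>2 / (D * s)" for x
  proof -
    have "0 \<le> (2 * f x - D * s)\<^sup>2 / (4 * (D * s))"
      using D_pos s by (intro divide_nonneg_pos) auto
    also have "\<dots> = D * s / 4 + (f x)\<^sup>2 / (D * s) - f x"
      using D_pos s by (simp add: field_simps power2_eq_square)
    finally show ?thesis by simp
  qed
  then have "(\<integral>\<^sup>+x. ennreal (exp (f x)) \<partial>M)
      \<le> (\<integral>\<^sup>+x. ennreal (exp (D * s / 4)) * ennreal (exp ((f x)\<^sup>2 / (D * s))) \<partial>M)"
    by (intro nn_integral_mono) (simp add: ennreal_mult[symmetric] exp_add[symmetric])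
  also have "\<dots> = ennreal (exp (D * s / 4)) * (\<integral>\<^sup>+x. ennreal (exp ((f x)\<^sup>2 / (D * s))) \<partial>M)"
    by (rule nn_integral_cmult) simp
  also have "\<dots> \<le> ennreal (exp (D * s / 4)) * 2"
    unfolding f_def by (intro mult_left_mono subgaussian I s) auto
  also have "\<dots> = ennreal (2 * exp (D * s / 4))"
    by (simp add: ennreal_mult' mult.commute)
  finally show ?thesis by (simp add: f_def)
qed

end

text \<open>One block \<open>I\<close> and a set \<open>A\<close> on which its functions are bounded by \<open>B\<close> and carry energy \<open>\<beta>\<close> per function.
  The parameter \<open>\<delta>\<close> of the Riesz product is chosen later, small in terms of \<open>B\<close>, \<open>D\<close> and \<open>\<beta>\<close>.\<close>

locale sign_block = subgaussian_family M J h D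
  for M :: "'a measure" and J :: "'i set" and h :: "'i \<Rightarrow> 'a \<Rightarrow> real" and D :: real +
  fixes I :: "'i set" and A :: "'a set" and B \<delta> \<beta> :: real
  assumes I: "finite I" "I \<subseteq> J"
    and A: "A \<in> sets M"
    and B: "1 \<le> B" "\<And>i x. i \<in> I \<Longrightarrow> x \<in> A \<Longrightarrow> \<bar>h i x\<bar> \<le> B"
    and \<beta>: "0 < \<beta>" "\<And>x. x \<in> A \<Longrightarrow> \<beta> * card I \<le> (\<Sum>i\<in>I. (h i x)\<^sup>2)"
    and \<delta>: "0 < \<delta>" "\<delta> * B \<le> 1 / 2"
    and prob_A_pos: "0 < prob A"
begin

abbreviation "n \<equiv> real (card I)"

definition riesz :: "'i set \<Rightarrow> 'a \<Rightarrow> real" where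
  "riesz S x = (\<Prod>i\<in>I. 1 + \<delta> * sgn_at S i * h i x)"

definition Z :: "'i set \<Rightarrow> real" where
  "Z S = (LINT x|M. indicator A x * riesz S x)"

definition W :: "'i set \<Rightarrow> real" where
  "W S = (LINT x|M. indicator A x * exp (\<delta> * rsum I S x))"

lemma h_meas [measurable]: "i \<in> I \<Longrightarrow> h i \<in> borel_measurable M"
  using h_measurable I by auto

lemma riesz_meas [measurable]: "riesz S \<in> borel_measurable M"
  unfolding riesz_def by measurable

lemma rsum_meas [measurable]: "rsum I S \<in> borel_measurable M"
  by (rule rsum_measurable[OF I(2)])

lemma A_meas [measurable]: "A \<in> sets M"
  by (rule A)

lemma integrable_on_A:
  fixes u :: "'a \<Rightarrow> real"
  assumes "u \<in> borel_measurable M" "\<And>x. x \<in> A \<Longrightarrow> \<bar>u x\<bar> \<le> K" "0 \<le> K"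
  shows "integrable M (\<lambda>x. indicator A x * u x)"
  using assms by (intro integrable_const_bound[of _ K]) (auto simp: indicator_def)

lemma rsum_bound: "x \<in> A \<Longrightarrow> \<bar>rsum I S x\<bar> \<le> B * n"
proof -
  assume x: "x \<in> A"
  have "\<bar>rsum I S x\<bar> \<le> (\<Sum>i\<in>I. \<bar>sgn_at S i * h i x\<bar>)"
    unfolding rsum_def by (rule sum_abs)
  also have "\<dots> \<le> (\<Sum>i\<in>I. B)"
    using B x by (intro sum_mono) (auto simp: abs_mult)
  finally show ?thesis by (simp add: mult.commute)
qed

lemma factor_bound:
  assumes "i \<in> I" "x \<in> A" shows "\<bar>\<delta> * sgn_at S i * h i x\<bar> \<le> 1 / 2"
proof -
  have "\<bar>\<delta> * sgn_at S i * h i x\<bar> \<le> \<delta> * B"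
    using B(2)[OF assms] \<delta> by (simp add: abs_mult)
  with \<delta>(2) show ?thesis by simp
qed

lemma factor_nonneg: "i \<in> I \<Longrightarrow> x \<in> A \<Longrightarrow> 0 \<le> 1 + \<delta> * sgn_at S i * h i x"
  using factor_bound[of i x S] by linarith

lemma riesz_nonneg: "x \<in> A \<Longrightarrow> 0 \<le> riesz S x"
  unfolding riesz_def by (intro prod_nonneg factor_nonneg)

lemma riesz_le:
  assumes "x \<in> A"
  shows "riesz S x \<le> exp (- (\<delta>\<^sup>2 * \<beta> * n / 4)) * exp (\<delta> * rsum I S x)"
proof -
  have "riesz S x \<le> (\<Prod>i\<in>I. exp (\<delta> * sgn_at S i * h i x - (\<delta> * sgn_at S i * h i x)\<^sup>2 / 4))"
    unfolding riesz_def
    by (intro prod_mono conjI one_plus_le_exp_minus_square factor_bound factor_nonneg assms)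
  also have "\<dots> = exp (\<Sum>i\<in>I. \<delta> * sgn_at S i * h i x - (\<delta> * sgn_at S i * h i x)\<^sup>2 / 4)"
    using I by (simp add: exp_sum)
  also have "(\<Sum>i\<in>I. \<delta> * sgn_at S i * h i x - (\<delta> * sgn_at S i * h i x)\<^sup>2 / 4)
      = \<delta> * rsum I S x - \<delta>\<^sup>2 / 4 * (\<Sum>i\<in>I. (h i x)\<^sup>2)"
    by (simp add: sum_subtractf rsum_def sum_distrib_left power_mult_distrib mult.assoc)
       (simp add: power2_eq_square)
  also have "\<dots> \<le> \<delta> * rsum I S x - \<delta>\<^sup>2 / 4 * (\<beta> * n)"
    using \<beta>(2)[OF assms] by (intro diff_left_mono mult_left_mono) auto
  finally show ?thesis
    by (simp add: algebra_simps flip: exp_add)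
qed

lemma exp_rsum_bound: "x \<in> A \<Longrightarrow> exp (\<delta> * rsum I S x) \<le> exp (\<delta> * B * n)"
  using rsum_bound[of x S] \<delta> by (simp add: abs_le_iff mult.assoc)

lemma integrable_W: "integrable M (\<lambda>x. indicator A x * exp (\<delta> * rsum I S x))"
  by (rule integrable_on_A[of _ "exp (\<delta> * B * n)"]) (use exp_rsum_bound in auto)

lemma riesz_bound: "x \<in> A \<Longrightarrow> \<bar>riesz S x\<bar> \<le> exp (\<delta> * B * n)"
proof -
  assume x: "x \<in> A"
  have "riesz S x \<le> 1 * exp (\<delta> * rsum I S x)"
    using \<beta> by (intro order_trans[OF riesz_le[OF x]] mult_right_mono) auto
  with riesz_nonneg[OF x, of S] exp_rsum_bound[OF x, of S] show ?thesis by linarith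
qed

lemma integrable_Z: "integrable M (\<lambda>x. indicator A x * riesz S x)"
  by (rule integrable_on_A[of _ "exp (\<delta> * B * n)"]) (use riesz_bound in auto)

lemma cube_mean_integral:
  fixes u :: "'i set \<Rightarrow> 'a \<Rightarrow> real"
  assumes "\<And>S. integrable M (u S)"
  shows "cube_mean I (\<lambda>S. LINT x|M. u S x) = (LINT x|M. cube_mean I (\<lambda>S. u S x))"
  using assms by (simp add: cube_mean_def)

lemma cube_mean_Z: "cube_mean I Z = prob A"
proof -
  have "cube_mean I Z = (LINT x|M. cube_mean I (\<lambda>S. indicator A x * riesz S x))"
    unfolding Z_def by (rule cube_mean_integral[OF integrable_Z])
  also have "\<dots> = (LINT x|M. indicator A x)"
  proof (intro Bochner_Integration.integral_cong refl)
    fix x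
    show "cube_mean I (\<lambda>S. indicator A x * riesz S x) = indicat_real A x"
      unfolding cube_mean_cmult riesz_def
      using cube_mean_prod[OF I(1), of "\<lambda>i r. 1 + \<delta> * r * h i x"] by simp
  qed
  finally show ?thesis by simp
qed

text \<open>Averaging two copies over the signs gives \<open>\<Prod>i. 1 + \<delta>\<^sup>2 * h i x * h i y\<close>. For fixed \<open>x\<close> this is at most
  the exponential of a linear combination of the \<open>h i y\<close> with coefficients \<open>\<delta>\<^sup>2 * h i x\<close>, whose squares sum
  to at most \<open>\<delta>\<^sup>4 * B\<^sup>2 * n\<close>; the fourth power of \<open>\<delta>\<close> is decisive for the comparison with
  the gain \<open>\<delta>\<^sup>2 * \<beta> * n\<close>.\<close>

lemma cube_mean_Z_square:
  "cube_mean I (\<lambda>S. (Z S)\<^sup>2) \<le> 2 * exp (\<delta> ^ 4 * D * B\<^sup>2 * n / 4) * prob A"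
proof -
  let ?Q = "2 * exp (\<delta> ^ 4 * D * B\<^sup>2 * n / 4)"
  have pair: "cube_mean I (\<lambda>S. riesz S x * riesz S y) = (\<Prod>i\<in>I. 1 + \<delta>\<^sup>2 * (h i x * h i y))" for x y
    unfolding riesz_def prod.distrib[symmetric]
    using cube_mean_prod[OF I(1), of "\<lambda>i r. (1 + \<delta> * r * h i x) * (1 + \<delta> * r * h i y)"]
    by (simp add: algebra_simps power2_eq_square add_divide_distrib)
  have inner: "cube_mean I (\<lambda>S. riesz S x * Z S) \<le> ?Q" if x: "x \<in> A" for x
  proof -
    have "cube_mean I (\<lambda>S. riesz S x * Z S)
        = cube_mean I (\<lambda>S. LINT y|M. indicator A y * (riesz S x * riesz S y))"
      unfolding Z_def by (intro cube_mean_cong) (simp add: mult.left_commute flip: integral_mult_right_zero)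
    also have "\<dots> = (LINT y|M. cube_mean I (\<lambda>S. indicator A y * (riesz S x * riesz S y)))"
      by (rule cube_mean_integral, subst mult.left_commute)
         (intro integrable_mult_right integrable_Z)
    also have "\<dots> = (LINT y|M. indicator A y * (\<Prod>i\<in>I. 1 + \<delta>\<^sup>2 * (h i x * h i y)))"
      unfolding cube_mean_cmult pair ..
    finally have eq: "cube_mean I (\<lambda>S. riesz S x * Z S)
        = (LINT y|M. indicator A y * (\<Prod>i\<in>I. 1 + \<delta>\<^sup>2 * (h i x * h i y)))" .
    have int: "integrable M (\<lambda>y. indicator A y * (\<Prod>i\<in>I. 1 + \<delta>\<^sup>2 * (h i x * h i y)))"
    proof (rule integrable_on_A)
      fix y assume y: "y \<in> A"
      have "\<bar>1 + \<delta>\<^sup>2 * (h i x * h i y)\<bar> \<le> 1 + \<delta>\<^sup>2 * (B * B)" if i: "i \<in> I" for i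
      proof -
        have "\<bar>\<delta>\<^sup>2 * (h i x * h i y)\<bar> \<le> \<delta>\<^sup>2 * (B * B)"
          unfolding abs_mult using B i x y by (intro mult_mono) auto
        then show ?thesis by linarith
      qed
      then show "\<bar>\<Prod>i\<in>I. 1 + \<delta>\<^sup>2 * (h i x * h i y)\<bar> \<le> (\<Prod>i\<in>I. 1 + \<delta>\<^sup>2 * (B * B))"
        unfolding abs_prod by (intro prod_mono) auto
    qed (auto intro!: prod_nonneg)
    have "ennreal (LINT y|M. indicator A y * (\<Prod>i\<in>I. 1 + \<delta>\<^sup>2 * (h i x * h i y)))
        \<le> (\<integral>\<^sup>+y. ennreal (norm (indicator A y * (\<Prod>i\<in>I. 1 + \<delta>\<^sup>2 * (h i x * h i y)))) \<partial>M)"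
      by (rule order_trans[OF ennreal_leI[OF abs_ge_self]], subst real_norm_def[symmetric])
         (intro integral_norm_bound_ennreal int)
    also have "\<dots> \<le> (\<integral>\<^sup>+y. ennreal (exp (\<Sum>i\<in>I. (\<delta>\<^sup>2 * h i x) * h i y)) \<partial>M)"
    proof (intro nn_integral_mono ennreal_leI)
      fix y
      show "norm (indicator A y * (\<Prod>i\<in>I. 1 + \<delta>\<^sup>2 * (h i x * h i y))) \<le> exp (\<Sum>i\<in>I. (\<delta>\<^sup>2 * h i x) * h i y)"
      proof (cases "y \<in> A")
        case True
        have f: "0 \<le> 1 + \<delta>\<^sup>2 * (h i x * h i y)" if i: "i \<in> I" for i
        proof -
          have "\<bar>(\<delta> * sgn_at {} i * h i x) * (\<delta> * sgn_at {} i * h i y)\<bar> \<le> 1 / 2 * (1 / 2)"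
            unfolding abs_mult[of "\<delta> * sgn_at {} i * h i x"]
            by (intro mult_mono factor_bound i x True) auto
          then show ?thesis
            by (simp add: power2_eq_square sgn_at_def algebra_simps abs_le_iff)
        qed
        have "(\<Prod>i\<in>I. 1 + \<delta>\<^sup>2 * (h i x * h i y)) \<le> (\<Prod>i\<in>I. exp (\<delta>\<^sup>2 * h i x * h i y))"
          using f by (intro prod_mono conjI) (auto simp: mult.assoc)
        with f show ?thesis
          using I True by (simp add: exp_sum prod_nonneg)
      qed simp
    qed
    also have "\<dots> \<le> ennreal (2 * exp (D * (\<delta> ^ 4 * B\<^sup>2 * n) / 4))" if "I \<noteq> {}"
    proof (rule exp_moment[OF I])
      show "0 < \<delta> ^ 4 * B\<^sup>2 * n"
        using \<delta> B I that by (simp add: card_gt_0_iff)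
      have "(\<Sum>j\<in>I. (\<delta>\<^sup>2 * h j x)\<^sup>2) \<le> (\<Sum>j\<in>I. \<delta> ^ 4 * B\<^sup>2)"
      proof (intro sum_mono)
        fix j assume "j \<in> I"
        then have "(h j x)\<^sup>2 \<le> B\<^sup>2"
          using B x by (metis abs_le_square_iff abs_of_nonneg order_trans zero_le_one)
        then show "(\<delta>\<^sup>2 * h j x)\<^sup>2 \<le> \<delta> ^ 4 * B\<^sup>2"
          by (simp add: power_mult_distrib mult_left_mono flip: power_mult)
      qed
      then show "(\<Sum>j\<in>I. (\<delta>\<^sup>2 * h j x)\<^sup>2) \<le> \<delta> ^ 4 * B\<^sup>2 * n"
        by (simp add: mult.commute)
    qed
    finally have "LINT y|M. indicator A y * (\<Prod>i\<in>I. 1 + \<delta>\<^sup>2 * (h i x * h i y))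
        \<le> 2 * exp (D * (\<delta> ^ 4 * B\<^sup>2 * n) / 4)" if "I \<noteq> {}"
      using that by (simp add: ennreal_le_iff)
    moreover have "LINT y|M. indicator A y * (\<Prod>i\<in>I. 1 + \<delta>\<^sup>2 * (h i x * h i y))
        \<le> 2 * exp (D * (\<delta> ^ 4 * B\<^sup>2 * n) / 4)" if "I = {}"
      using that by simp (use prob_le_1[of A] in linarith)
    ultimately show ?thesis
      unfolding eq by (cases "I = {}") (simp_all add: mult_ac)
  qed
  have "cube_mean I (\<lambda>S. (Z S)\<^sup>2) = cube_mean I (\<lambda>S. LINT x|M. indicator A x * (riesz S x * Z S))"
    unfolding power2_eq_square
    by (intro cube_mean_cong, subst (2) Z_def) (simp flip: integral_mult_right_zero add: mult_ac)
  also have "\<dots> = (LINT x|M. cube_mean I (\<lambda>S. indicator A x * (riesz S x * Z S)))"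
    by (rule cube_mean_integral, subst mult.assoc[symmetric])
       (intro integrable_mult_left integrable_Z)
  also have "\<dots> \<le> (LINT x|M. indicator A x * ?Q)"
  proof (rule integral_mono)
    show "integrable M (\<lambda>x. cube_mean I (\<lambda>S. indicator A x * (riesz S x * Z S)))"
      unfolding cube_mean_def
      by (intro integrable_divide_zero Bochner_Integration.integrable_sum, subst mult.assoc[symmetric])
         (intro integrable_mult_left integrable_Z)
    show "integrable M (\<lambda>x. indicator A x * ?Q)"
      by (rule integrable_on_A[of _ ?Q]) auto
    show "cube_mean I (\<lambda>S. indicator A x * (riesz S x * Z S)) \<le> indicator A x * ?Q" for x
      unfolding cube_mean_cmult using inner[of x] by (auto simp: indicator_def)
  qed
  also have "\<dots> = ?Q * prob A"
    by simp
  finally show ?thesis .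
qed

text \<open>The Paley-Zygmund inequality for \<open>Z\<close>.\<close>

lemma prob_Z_large:
  "prob A * exp (- (\<delta> ^ 4 * D * B\<^sup>2 * n / 4)) / 8 \<le> card {S\<in>Pow I. prob A / 2 \<le> Z S} / 2 ^ card I"
proof -
  define Q where "Q = 2 * exp (\<delta> ^ 4 * D * B\<^sup>2 * n / 4) * prob A"
  define G where "G = {S\<in>Pow I. prob A / 2 \<le> Z S}"
  define p where "p = card G / 2 ^ card I"
  define s where "s = prob A / (4 * Q)"
  have Q: "0 < Q" and s: "0 < s"
    using prob_A_pos by (simp_all add: Q_def s_def)
  have "prob A \<le> cube_mean I (\<lambda>S. prob A / 2 + (s * (Z S)\<^sup>2 + indicator G S / (4 * s)))"
    unfolding cube_mean_Z[symmetric]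
  proof (rule cube_mean_mono)
    fix S assume S: "S \<subseteq> I"
    \<comment> \<open>Cauchy-Schwarz in the form \<open>Z \<le> s * Z\<^sup>2 + 1 / (4 * s)\<close>; the value of \<open>s\<close> is the one that lets the first
      term absorb a quarter of \<open>prob A\<close>.\<close>
    have "0 \<le> s * (Z S - 1 / (2 * s))\<^sup>2"
      using s by simp
    also have "\<dots> = s * (Z S)\<^sup>2 + 1 / (4 * s) - Z S"
      using s by (simp add: power2_eq_square field_simps)
    finally have "Z S \<le> s * (Z S)\<^sup>2 + 1 / (4 * s)" by simp
    moreover have "0 \<le> s * (Z S)\<^sup>2"
      using s by simp
    ultimately show "Z S \<le> cube_mean I Z / 2 + (s * (Z S)\<^sup>2 + indicator G S / (4 * s))"
      using S unfolding cube_mean_Z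
      by (cases "S \<in> G") (auto simp: G_def intro: add_increasing)
  qed
  also have "\<dots> = prob A / 2 + (s * cube_mean I (\<lambda>S. (Z S)\<^sup>2) + p / (4 * s))"
  proof -
    have "cube_mean I (\<lambda>S. indicator G S / (4 * s)) = p / (4 * s)"
      unfolding cube_mean_def p_def using I
      by (simp add: indicator_def sum.If_cases G_def Int_def flip: sum_divide_distrib)
    then show ?thesis
      using I by (simp add: cube_mean_add cube_mean_cmult)
  qed
  also have "\<dots> \<le> prob A / 2 + (s * Q + p / (4 * s))"
    using cube_mean_Z_square s by (simp add: Q_def)
  also have "\<dots> = prob A / 2 + (prob A / 4 + p * Q / prob A)"
    using Q prob_A_pos by (simp add: s_def)
  finally have "prob A * prob A / (4 * Q) \<le> p"
    using Q prob_A_pos by (simp add: field_simps)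
  then show ?thesis
    using prob_A_pos unfolding p_def[symmetric] G_def[symmetric]
    by (simp add: Q_def p_def exp_minus field_simps)
qed

lemma Z_le_W: "Z S \<le> exp (- (\<delta>\<^sup>2 * \<beta> * n / 4)) * W S"
proof -
  have "Z S \<le> (LINT x|M. exp (- (\<delta>\<^sup>2 * \<beta> * n / 4)) * (indicator A x * exp (\<delta> * rsum I S x)))"
    unfolding Z_def
  proof (rule integral_mono)
    show "indicator A x * riesz S x
        \<le> exp (- (\<delta>\<^sup>2 * \<beta> * n / 4)) * (indicator A x * exp (\<delta> * rsum I S x))" for x
      using riesz_le[of x S] by (auto simp: indicator_def)
  qed (intro integrable_Z integrable_mult_right integrable_W)+
  then show ?thesis by (simp add: W_def)
qed

lemma W_pos: "0 < W S"
proof -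
  have "exp (- (\<delta> * B * n)) * prob A = (LINT x|M. indicator A x * exp (- (\<delta> * B * n)))"
    by simp
  also have "\<dots> \<le> W S"
    unfolding W_def
  proof (rule integral_mono)
    show "integrable M (\<lambda>x. indicator A x * exp (- (\<delta> * B * n)))"
      by (rule integrable_on_A[of _ "exp (- (\<delta> * B * n))"]) auto
    show "indicat_real A x * exp (- (\<delta> * B * n)) \<le> indicator A x * exp (\<delta> * rsum I S x)" for x
      using rsum_bound[of x S] mult_left_mono[of "- (B * n)" "rsum I S x" \<delta>] \<delta>
      by (auto simp: indicator_def abs_le_iff mult.assoc)
  qed (rule integrable_W)
  finally show ?thesis
    using prob_A_pos by (smt (verit) exp_gt_zero mult_pos_pos)
qed

lemma W_le: "W S \<le> exp (\<delta> * B * n)"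
proof -
  have "W S \<le> (LINT x|M. exp (\<delta> * B * n))"
    unfolding W_def
  proof (rule integral_mono)
    show "indicator A x * exp (\<delta> * rsum I S x) \<le> exp (\<delta> * B * n)" for x
      using exp_rsum_bound[of x S] by (auto simp: indicator_def)
  qed (auto intro: integrable_W)
  then show ?thesis by (simp add: prob_space)
qed

lemma W_flip:
  assumes "\<And>x. x \<in> A \<Longrightarrow> \<bar>rsum I S x - rsum I T x\<bar> \<le> 2 * B"
  shows "ln (W S) \<le> ln (W T) + 2 * (\<delta> * B)"
proof -
  have "W S \<le> (LINT x|M. exp (2 * (\<delta> * B)) * (indicator A x * exp (\<delta> * rsum I T x)))"
    unfolding W_def
  proof (rule integral_mono)
    show "indicator A x * exp (\<delta> * rsum I S x)
        \<le> exp (2 * (\<delta> * B)) * (indicator A x * exp (\<delta> * rsum I T x))" for x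
    proof (cases "x \<in> A")
      case True
      have "rsum I S x \<le> rsum I T x + 2 * B"
        using assms[OF True] by linarith
      then have "\<delta> * rsum I S x \<le> \<delta> * (rsum I T x + 2 * B)"
        using \<delta> by (intro mult_left_mono) auto
      then show ?thesis
        using True by (simp add: algebra_simps flip: exp_add)
    qed simp
  qed (intro integrable_W integrable_mult_right)+
  then have "W S \<le> exp (2 * (\<delta> * B)) * W T"
    by (simp add: W_def)
  then have "ln (W S) \<le> ln (exp (2 * (\<delta> * B)) * W T)"
    using W_pos[of S] W_pos[of T] by simp
  also have "\<dots> = ln (W T) + 2 * (\<delta> * B)"
    using W_pos[of T] by (simp add: ln_mult)
  finally show ?thesis .
qed

lemma rsum_insert:
  assumes "i \<in> I" "i \<notin> S"
  shows "rsum I (insert i S) x - rsum I S x = 2 * h i x"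
proof -
  have "rsum I (insert i S) x - rsum I S x = (\<Sum>k\<in>I. if k = i then 2 * h i x else 0)"
    unfolding rsum_def sum_subtractf[symmetric]
    using assms by (intro sum.cong refl) (auto simp: sgn_at_def)
  then show ?thesis
    using I assms by simp
qed

text \<open>Where \<open>Z\<close> is large, \<open>ln W\<close> is at least \<open>\<tau>\<close>, which is nearly \<open>\<delta>\<^sup>2 * \<beta> * n / 4\<close>. That event has probability
  at least \<open>exp (- O(\<delta>\<^sup>4 * n))\<close>. Comparing its contribution to the mean of \<open>exp (\<delta> * ln W)\<close> with
  the concentration bound shows that the mean of \<open>ln W\<close> falls below \<open>\<tau>\<close> by \<open>O(\<delta>\<^sup>3 * n)\<close> only. The exponent
  \<open>\<delta>\<close> balances the two losses \<open>O(\<delta>\<^sup>4 * n / \<delta>)\<close> and \<open>O(\<delta> * \<delta>\<^sup>2 * n)\<close>.\<close>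

lemma cube_mean_ln_W:
  assumes "\<delta> \<le> 1" "\<delta> * (2 + D * B\<^sup>2 / 4 + B\<^sup>2 / 2) \<le> \<beta> / 8"
    and large: "8 * exp (- (\<delta> ^ 4 * n)) \<le> prob A"
  shows "\<delta>\<^sup>2 * \<beta> * n / 8 \<le> cube_mean I (\<lambda>S. ln (W S))"
proof -
  define p where "p = card {S\<in>Pow I. prob A / 2 \<le> Z S} / 2 ^ card I"
  define G where "G = {S\<in>Pow I. prob A / 2 \<le> Z S}"
  define \<tau> where "\<tau> = - (\<delta> ^ 4 * n) + \<delta>\<^sup>2 * \<beta> * n / 4"
  have W_large: "\<tau> \<le> ln (W S)" if "S \<in> G" for S
  proof -
    have "exp (- (\<delta> ^ 4 * n)) \<le> exp (- (\<delta>\<^sup>2 * \<beta> * n / 4)) * W S"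
      using large Z_le_W[of S] exp_ge_zero[of "- (\<delta> ^ 4 * n)"] that
      unfolding G_def mem_Collect_eq by linarith
    then have "exp (\<delta>\<^sup>2 * \<beta> * n / 4) * exp (- (\<delta> ^ 4 * n))
        \<le> exp (\<delta>\<^sup>2 * \<beta> * n / 4) * (exp (- (\<delta>\<^sup>2 * \<beta> * n / 4)) * W S)"
      by (rule mult_left_mono) simp
    then have "exp \<tau> \<le> W S"
      by (simp add: \<tau>_def add.commute flip: exp_add mult.assoc)
    then show ?thesis
      using W_pos[of S] by (simp add: ln_ge_iff)
  qed
  have "exp (- (\<delta> ^ 4 * n)) * exp (- (\<delta> ^ 4 * D * B\<^sup>2 * n / 4)) \<le> p"
    using large by (intro order_trans[OF _ prob_Z_large[folded p_def]]) simp
  then have "exp (- (\<delta> ^ 4 * n)) * exp (- (\<delta> ^ 4 * D * B\<^sup>2 * n / 4)) * exp (\<delta> * \<tau>) \<le> p * exp (\<delta> * \<tau>)"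
    by (rule mult_right_mono) simp
  also have "p * exp (\<delta> * \<tau>) = (\<Sum>S\<in>G. exp (\<delta> * \<tau>)) / 2 ^ card I"
    by (simp add: p_def G_def)
  also have "\<dots> \<le> (\<Sum>S\<in>G. exp (\<delta> * ln (W S))) / 2 ^ card I"
    using W_large \<delta> by (intro divide_right_mono sum_mono) auto
  also have "\<dots> \<le> cube_mean I (\<lambda>S. exp (\<delta> * ln (W S)))"
    unfolding cube_mean_def using I by (intro divide_right_mono sum_mono2) (auto simp: G_def)
  also have "\<dots> \<le> exp (\<delta> * cube_mean I (\<lambda>S. ln (W S)) + \<delta>\<^sup>2 * (\<delta> * B)\<^sup>2 * card I / 2)"
  proof (rule cube_mean_exp_le[OF I(1)])
    fix S i assume i: "i \<in> I" "S \<subseteq> I - {i}"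
    have "\<bar>rsum I (insert i S) x - rsum I S x\<bar> \<le> 2 * B" if "x \<in> A" for x
    proof -
      have "i \<notin> S" using i by auto
      then show ?thesis
        using rsum_insert[of i S x] i B(2)[of i x] that by (simp add: abs_mult)
    qed
    then have "ln (W (insert i S)) \<le> ln (W S) + 2 * (\<delta> * B)"
      and "ln (W S) \<le> ln (W (insert i S)) + 2 * (\<delta> * B)"
      by (intro W_flip; simp add: abs_minus_commute)+
    then show "\<bar>ln (W (insert i S)) - ln (W S)\<bar> \<le> 2 * (\<delta> * B)"
      by linarith
  qed
  finally have "- (\<delta> ^ 4 * n) - \<delta> ^ 4 * D * B\<^sup>2 * n / 4 + \<delta> * \<tau>
      \<le> \<delta> * cube_mean I (\<lambda>S. ln (W S)) + \<delta>\<^sup>2 * (\<delta> * B)\<^sup>2 * n / 2"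
    by (simp flip: exp_add)
  then have "\<delta> * (\<delta>\<^sup>2 * \<beta> * n / 4 - \<delta>\<^sup>2 * n * (\<delta> * (\<delta> + 1 + D * B\<^sup>2 / 4 + B\<^sup>2 / 2)))
      \<le> \<delta> * cube_mean I (\<lambda>S. ln (W S))"
    by (simp add: \<tau>_def algebra_simps power2_eq_square eval_nat_numeral)
  then have "\<delta>\<^sup>2 * \<beta> * n / 4 - \<delta>\<^sup>2 * n * (\<delta> * (\<delta> + 1 + D * B\<^sup>2 / 4 + B\<^sup>2 / 2))
      \<le> cube_mean I (\<lambda>S. ln (W S))"
    using \<delta> by simp
  moreover have "\<delta>\<^sup>2 * n * (\<delta> * (\<delta> + 1 + D * B\<^sup>2 / 4 + B\<^sup>2 / 2)) \<le> \<delta>\<^sup>2 * n * (\<beta> / 8)"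
  proof (rule mult_left_mono)
    have "\<delta> * (\<delta> + 1 + D * B\<^sup>2 / 4 + B\<^sup>2 / 2) \<le> \<delta> * (2 + D * B\<^sup>2 / 4 + B\<^sup>2 / 2)"
      using \<delta> assms(1) by (intro mult_left_mono) auto
    with assms(2) show "\<delta> * (\<delta> + 1 + D * B\<^sup>2 / 4 + B\<^sup>2 / 2) \<le> \<beta> / 8" by linarith
  qed simp
  moreover have "\<delta>\<^sup>2 * n * (\<beta> / 8) = \<delta>\<^sup>2 * \<beta> * n / 8" by simp
  ultimately show ?thesis by linarith
qed

text \<open>A large mean of \<open>ln W\<close> together with the trivial upper bound \<open>\<delta> * B * n\<close> yields many signs with large \<open>W\<close>.
  For such signs the part of \<open>A\<close> on which the signed sum is small contributes too little to \<open>W\<close>, so the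
  complementary part cannot be too small.\<close>

lemma many_signs_large_rsum:
  assumes "\<delta> \<le> 1" "\<delta> * (2 + D * B\<^sup>2 / 4 + B\<^sup>2 / 2) \<le> \<beta> / 8"
    and "8 * exp (- (\<delta> ^ 4 * n)) \<le> prob A"
    and n: "32 \<le> \<delta>\<^sup>2 * \<beta> * n"
  shows "\<delta> * \<beta> / (16 * B) * 2 ^ card I
    \<le> card {S\<in>Pow I. exp (- (\<delta> * B * n)) \<le> prob {x\<in>A. \<delta> * \<beta> / 32 * n \<le> rsum I S x}}"
proof -
  define y where "y = \<delta>\<^sup>2 * \<beta> * n / 32"
  have y: "1 \<le> y" using n by (simp add: y_def)
  have "0 < n" using n \<beta> by (cases "I = {}") auto
  define G where "G = {S\<in>Pow I. 2 * y \<le> ln (W S)}"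
  have "4 * y \<le> cube_mean I (\<lambda>S. ln (W S))"
    unfolding y_def using cube_mean_ln_W[OF assms(1-3)] by linarith
  also have "\<dots> \<le> cube_mean I (\<lambda>S. 2 * y + \<delta> * B * n * indicator G S)"
  proof (rule cube_mean_mono)
    fix S assume "S \<subseteq> I"
    moreover have "ln (W S) \<le> \<delta> * B * n"
      using W_le[of S] W_pos[of S] by (metis exp_ln exp_le_cancel_iff)
    ultimately show "ln (W S) \<le> 2 * y + \<delta> * B * n * indicator G S"
      using y by (auto simp: G_def indicator_def)
  qed
  also have "\<dots> = 2 * y + \<delta> * B * n * (card G / 2 ^ card I)"
    using I by (simp add: cube_mean_add cube_mean_cmult)
      (simp add: cube_mean_def indicator_def sum.If_cases G_def Int_def)
  finally have "2 * y / (\<delta> * B * n) \<le> card G / 2 ^ card I"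
    using \<delta> B \<open>0 < n\<close> by (simp add: field_simps)
  also have "2 * y / (\<delta> * B * n) = \<delta> * \<beta> / (16 * B)"
    using \<delta> B \<open>0 < n\<close> by (simp add: y_def power2_eq_square field_simps)
  finally have G: "\<delta> * \<beta> / (16 * B) * 2 ^ card I \<le> card G"
    by (simp add: field_simps)
  have "exp (- (\<delta> * B * n)) \<le> prob {x\<in>A. \<delta> * \<beta> / 32 * n \<le> rsum I S x}" if "S \<in> G" for S
  proof -
    define A' where "A' = {x\<in>A. \<delta> * \<beta> / 32 * n \<le> rsum I S x}"
    have A': "A' \<in> sets M"
    proof -
      have "A' = A \<inter> {x\<in>space M. \<delta> * \<beta> / 32 * n \<le> rsum I S x}"
        using sets.sets_into_space[OF A] by (auto simp: A'_def)
      then show ?thesis by simp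
    qed
    have "exp (2 * y) \<le> W S"
      using that W_pos[of S] by (simp add: G_def ln_ge_iff)
    also have "\<dots> \<le> (LINT x|M. exp y + indicator A' x * exp (\<delta> * B * n))"
      unfolding W_def
    proof (rule integral_mono)
      show "integrable M (\<lambda>x. exp y + indicator A' x * exp (\<delta> * B * n))"
        using A' by (auto intro!: integrable_mult_left simp: emeasure_eq_measure)
      show "indicator A x * exp (\<delta> * rsum I S x) \<le> exp y + indicator A' x * exp (\<delta> * B * n)" for x
      proof (cases "x \<in> A'")
        case True
        then show ?thesis
          using exp_rsum_bound[of x S] by (auto simp: A'_def add_increasing)
      next
        case False
        show ?thesis
        proof (cases "x \<in> A")
          case True
          then have "rsum I S x \<le> \<delta> * \<beta> / 32 * n" using False by (simp add: A'_def)
          then have "\<delta> * rsum I S x \<le> \<delta> * (\<delta> * \<beta> / 32 * n)"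
            using \<delta> by (intro mult_left_mono) auto
          then show ?thesis
            using True False by (simp add: y_def power2_eq_square mult.assoc)
        qed (use False in simp)
      qed
    qed (rule integrable_W)
    also have "\<dots> = exp y + prob A' * exp (\<delta> * B * n)"
      using A' by (simp add: prob_space emeasure_eq_measure)
    finally have "exp (2 * y) - exp y \<le> prob A' * exp (\<delta> * B * n)" by simp
    moreover have "1 \<le> exp (2 * y) - exp y"
    proof -
      have e: "2 \<le> exp y" using exp_ge_add_one_self[of y] y by linarith
      have "exp (2 * y) - exp y = exp y * (exp y - 1)"
        by (simp add: algebra_simps flip: exp_add)
      moreover have "2 * 1 \<le> exp y * (exp y - 1)"
        using e by (intro mult_mono) auto
      ultimately show ?thesis by linarith
    qed
    ultimately have "1 \<le> prob A' * exp (\<delta> * B * n)" by linarith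
    then have "exp (- (\<delta> * B * n)) \<le> prob A'"
      by (simp add: exp_minus field_simps)
    then show ?thesis by (simp add: A'_def)
  qed
  then have "card G \<le> card {S\<in>Pow I. exp (- (\<delta> * B * n)) \<le> prob {x\<in>A. \<delta> * \<beta> / 32 * n \<le> rsum I S x}}"
    using I by (intro card_mono) (auto simp: G_def)
  with G show ?thesis by linarith
qed

end

section \<open>Lacunary sequences of blocks\<close>

locale bounded_subgaussian_family = subgaussian_family M J h D
  for M :: "'a measure" and J :: "'i set" and h :: "'i \<Rightarrow> 'a \<Rightarrow> real" and D :: real +
  fixes B :: real and \<Omega>0 :: "'a set"
  assumes B_ge_1: "1 \<le> B"
    and \<Omega>0: "\<Omega>0 \<in> sets M" "prob \<Omega>0 = 1"
    and h_bound: "i \<in> J \<Longrightarrow> x \<in> \<Omega>0 \<Longrightarrow> \<bar>h i x\<bar> \<le> B"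
    and h_energy: "i \<in> J \<Longrightarrow> 1 / 2 \<le> (LINT x|M. (h i x)\<^sup>2)"
begin

definition energetic :: "'i set \<Rightarrow> 'a set" where
  "energetic I = {x \<in> \<Omega>0. 1 / 4 * card I \<le> (\<Sum>i\<in>I. (h i x)\<^sup>2)}"

text \<open>The conclusion for one block with all constants independent of the block and of \<open>A\<close>. It is essential
  that \<open>A\<close> may be exponentially small in the size of the block.\<close>

lemma block_constants:
  obtains c q \<kappa> K N :: real
  where "0 < c" "0 < q" "0 < \<kappa>" "0 < K"
    and "\<And>I A. finite I \<Longrightarrow> I \<subseteq> J \<Longrightarrow> N \<le> card I \<Longrightarrow> A \<in> sets M \<Longrightarrow> A \<subseteq> energetic I \<Longrightarrow>
      8 * exp (- (\<kappa> * card I)) \<le> prob A \<Longrightarrow>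
      q * 2 ^ card I \<le> card {S\<in>Pow I. exp (- (K * card I)) \<le> prob {x\<in>A. c * card I \<le> rsum I S x}}"
proof -
  define R where "R = 2 + D * B\<^sup>2 / 4 + B\<^sup>2 / 2"
  define \<delta> where "\<delta> = 1 / (32 * (B + R))"
  have R: "2 \<le> R" using D_pos by (simp add: R_def)
  have d0: "0 < \<delta>" "\<delta> \<le> 1" "\<delta> * B \<le> 1 / 2" "\<delta> * R \<le> 1 / 32"
    using R B_ge_1 by (simp_all add: \<delta>_def field_simps)
  show ?thesis
  proof (rule that[of "\<delta> * (1 / 4) / 32" "\<delta> * (1 / 4) / (16 * B)" "\<delta> ^ 4" "\<delta> * B" "128 / \<delta>\<^sup>2"])
    fix I and A :: "'a set"
    assume fin: "finite I" "I \<subseteq> J" and large: "128 / \<delta>\<^sup>2 \<le> card I"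
      and sub: "A \<in> sets M" "A \<subseteq> energetic I" "8 * exp (- (\<delta> ^ 4 * card I)) \<le> prob A"
    interpret sign_block M J h D I A B \<delta> "1 / 4"
    proof unfold_locales
      show "0 < prob A"
        using sub(3) exp_gt_zero[of "- (\<delta> ^ 4 * card I)"] by linarith
    qed (use fin sub d0 B_ge_1 h_bound in \<open>auto simp: energetic_def subset_iff\<close>)
    show "\<delta> * (1 / 4) / (16 * B) * 2 ^ card I
      \<le> card {S\<in>Pow I. exp (- (\<delta> * B * card I)) \<le> prob {x\<in>A. \<delta> * (1 / 4) / 32 * card I \<le> rsum I S x}}"
    proof (rule many_signs_large_rsum)
      show "32 \<le> \<delta>\<^sup>2 * (1 / 4) * real (card I)"
        using large d0 by (simp add: field_simps)
    qed (use d0 sub in \<open>simp_all add: R_def\<close>)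
  qed (use d0 B_ge_1 in auto)
qed

lemma energetic_measurable [measurable]:
  assumes "I \<subseteq> J" shows "energetic I \<in> sets M"
proof -
  have [measurable]: "i \<in> I \<Longrightarrow> h i \<in> borel_measurable M" for i
    using assms h_measurable by auto
  have "energetic I = \<Omega>0 \<inter> {x \<in> space M. 1 / 4 * card I \<le> (\<Sum>i\<in>I. (h i x)\<^sup>2)}"
    using sets.sets_into_space[OF \<Omega>0(1)] by (auto simp: energetic_def)
  also have "\<dots> \<in> sets M"
    using \<Omega>0 by measurable
  finally show ?thesis .
qed

lemma AE_\<Omega>0: "AE x in M. x \<in> \<Omega>0"
  using prob_eq_1[OF \<Omega>0(1)] \<Omega>0(2) by simp

text \<open>The mean of \<open>\<Sum>i\<in>I. (h i x)\<^sup>2\<close> is at least \<open>n / 2\<close> and its maximum is at most \<open>B\<^sup>2 * n\<close>.\<close>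

lemma prob_energetic:
  assumes I: "finite I" "I \<subseteq> J" "I \<noteq> {}"
  shows "1 / (4 * B\<^sup>2) \<le> prob (energetic I)"
proof -
  have [measurable]: "i \<in> I \<Longrightarrow> h i \<in> borel_measurable M" for i
    using I h_measurable by auto
  note [measurable] = energetic_measurable[OF I(2)]
  have sq: "(h i x)\<^sup>2 \<le> B\<^sup>2" if "i \<in> I" "x \<in> \<Omega>0" for i x
    using h_bound[of i x] B_ge_1 that I
    by (metis abs_le_square_iff abs_of_nonneg order_trans subsetD zero_le_one)
  have int: "integrable M (\<lambda>x. (h i x)\<^sup>2)" if "i \<in> I" for i
    using AE_\<Omega>0 that by (intro integrable_const_bound[of _ "B\<^sup>2"]) (auto elim!: eventually_mono intro: sq)
  have "1 / 2 * card I = (\<Sum>i\<in>I. 1 / 2)" by simp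
  also have "\<dots> \<le> (\<Sum>i\<in>I. LINT x|M. (h i x)\<^sup>2)"
    using I by (intro sum_mono h_energy) auto
  also have "\<dots> = (LINT x|M. (\<Sum>i\<in>I. (h i x)\<^sup>2))"
    by (simp add: int)
  also have "\<dots> \<le> (LINT x|M. 1 / 4 * card I + B\<^sup>2 * card I * indicator (energetic I) x)"
  proof (rule integral_mono_AE)
    show "AE x in M. (\<Sum>i\<in>I. (h i x)\<^sup>2) \<le> 1 / 4 * card I + B\<^sup>2 * card I * indicator (energetic I) x"
      using AE_\<Omega>0
    proof eventually_elim
      case (elim x)
      have "(\<Sum>i\<in>I. (h i x)\<^sup>2) \<le> (\<Sum>i\<in>I. B\<^sup>2)"
        using elim by (intro sum_mono sq) auto
      with elim show ?case
        by (auto simp: energetic_def indicator_def mult.commute add_increasing)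
    qed
  qed (auto simp: int emeasure_eq_measure intro!: integrable_mult_right)
  also have "\<dots> = 1 / 4 * card I + B\<^sup>2 * card I * prob (energetic I)"
    by (simp add: prob_space emeasure_eq_measure)
  finally have "1 / 4 * card I \<le> B\<^sup>2 * card I * prob (energetic I)" by linarith
  moreover have "0 < real (card I)" using I by (simp add: card_gt_0_iff)
  ultimately show ?thesis
    using B_ge_1 by (simp add: field_simps)
qed

text \<open>
  The supremum over \<open>A\<close> appears as an arbitrary function \<open>g\<close> of the signs that bounds the sum on \<open>A\<close>.

  The sets on which different blocks have energy may be disjoint, so no point need serve all blocks.
  The number \<open>v\<close> is a lower bound, valid at every point of \<open>A\<close>, for the total weight of the blocks
  that have energy there. For the first block, \<open>A\<close> is cut into the part with energy and the part without,
  and the larger half is kept. Without energy the block contributed nothing to \<open>v\<close>, and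
  nothing is lost. With energy \<open>v\<close> drops by the weight \<open>p\<close> of the block, but with probability at least \<open>q\<close> the
  signed sum gains \<open>c * p\<close> on a subset of \<open>A\<close>. In all other cases the sum of the block may be
  negative; the subgaussian tail allows restriction to the points at which it is at most \<open>\<epsilon> * n\<close> in absolute value.
  The remaining set is large enough for the next block by the growth of the sizes.
\<close>

lemma lacunary_chain:
  fixes c q \<epsilon> \<theta> K N L :: real and I :: "nat \<Rightarrow> 'i set" and b :: "nat \<Rightarrow> real"
  assumes const: "0 \<le> c" "0 \<le> q" "0 \<le> \<epsilon>" "0 < N"
    and block: "\<And>I A. finite I \<Longrightarrow> I \<subseteq> J \<Longrightarrow> N \<le> card I \<Longrightarrow> A \<in> sets M \<Longrightarrow> A \<subseteq> energetic I \<Longrightarrow>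
      exp (- (\<theta> * card I)) / 2 \<le> prob A \<Longrightarrow>
      q * 2 ^ card I \<le> card {S\<in>Pow I. exp (- (K * card I)) \<le> prob {x\<in>A. c * card I \<le> rsum I S x}}"
    and tail: "\<And>n. N \<le> n \<Longrightarrow> 2 * exp (- (\<epsilon>\<^sup>2 * n / D)) \<le> exp (- (\<theta> * n)) / 4"
    and growth: "\<And>n n'. N \<le> n \<Longrightarrow> L * n \<le> n' \<Longrightarrow>
      exp (- (\<theta> * n')) \<le> exp (- (K * n)) \<and> exp (- (\<theta> * n')) \<le> exp (- (\<theta> * n)) / 4"
  assumes "\<And>k. k < d \<Longrightarrow> finite (I k) \<and> I k \<subseteq> J \<and> N \<le> card (I k) \<and> 0 \<le> b k"
    and "\<And>k l. k < d \<Longrightarrow> l < d \<Longrightarrow> k \<noteq> l \<Longrightarrow> I k \<inter> I l = {}"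
    and "\<And>k. Suc k < d \<Longrightarrow> L * card (I k) \<le> card (I (Suc k))"
    and "A \<in> sets M" "A \<subseteq> \<Omega>0" "0 < prob A" "0 < d \<Longrightarrow> exp (- (\<theta> * card (I 0))) \<le> prob A"
    and "\<And>x. x \<in> A \<Longrightarrow> v \<le> (\<Sum>k<d. b k * card (I k) * indicator (energetic (I k)) x)"
    and "\<And>S x. S \<subseteq> (\<Union>k<d. I k) \<Longrightarrow> x \<in> A \<Longrightarrow> (\<Sum>k<d. b k * rsum (I k) S x) \<le> g S"
  shows "q * c * v - \<epsilon> * (\<Sum>k<d. b k * card (I k)) \<le> cube_mean (\<Union>k<d. I k) g"
  using assms(8-)
proof (induction d arbitrary: I b A v g)
  case 0
  have "A \<noteq> {}" using "0.prems"(6) by auto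
  then obtain x where x: "x \<in> A" by auto
  have "q * c * v \<le> 0"
    using "0.prems"(8)[OF x] const by (simp add: mult_nonneg_nonpos)
  also have "0 \<le> g {}" using "0.prems"(9)[OF _ x, of "{}"] by simp
  finally show ?case by simp
next
  case (Suc d)
  note blocks = Suc.prems(1) and disj = Suc.prems(2) and lac = Suc.prems(3)
    and A = Suc.prems(4-7) and v = Suc.prems(8) and g = Suc.prems(9)
  define U where "U = (\<Union>k<d. I (Suc k))"
  define n where "n = real (card (I 0))"
  define tl where "tl = (\<Sum>k<d. b (Suc k) * card (I (Suc k)))"
  have I0: "finite (I 0)" "I 0 \<subseteq> J" "N \<le> n" "0 \<le> b 0"
    using blocks[of 0] by (auto simp: n_def)
  have I0ne: "I 0 \<noteq> {}" using I0 const by (auto simp: n_def)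
  note [measurable] = energetic_measurable[OF I0(2)] rsum_measurable[OF I0(2)] A(1)
  have finU: "finite U" unfolding U_def using blocks by auto
  have dU: "I 0 \<inter> U = {}" unfolding U_def using disj[of 0] by fastforce
  have UI: "(\<Union>k<Suc d. I k) = I 0 \<union> U"
    unfolding U_def by (auto simp: less_Suc_eq_0_disj)
  have big_A: "exp (- (\<theta> * n)) \<le> prob A" using A(4) by (simp add: n_def)
  have meas_sub: "{x \<in> A'. P (rsum (I 0) S x)} \<in> sets M"
    if "A' \<in> sets M" "Measurable.pred borel P" for A' P S
  proof -
    have "{x \<in> A'. P (rsum (I 0) S x)} = A' \<inter> {x \<in> space M. P (rsum (I 0) S x)}"
      using sets.sets_into_space[OF that(1)] by auto
    then show ?thesis using that by simp
  qed
  have step: "q * c * v' + w - \<epsilon> * tl \<le> cube_mean U (\<lambda>T. g (S \<union> T))"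
    if S: "S \<subseteq> I 0" and A': "A' \<in> sets M" "A' \<subseteq> A"
      and big: "exp (- (\<theta> * n)) / 4 \<le> prob A' \<or> exp (- (K * n)) \<le> prob A'"
      and v': "\<And>x. x \<in> A' \<Longrightarrow> v' \<le> (\<Sum>k<d. b (Suc k) * card (I (Suc k)) * indicator (energetic (I (Suc k))) x)"
      and w: "\<And>x. x \<in> A' \<Longrightarrow> w \<le> b 0 * rsum (I 0) S x"
    for S A' v' w
  proof -
    have "q * c * v' - \<epsilon> * (\<Sum>k<d. b (Suc k) * card (I (Suc k)))
        \<le> cube_mean (\<Union>k<d. I (Suc k)) (\<lambda>T. g (S \<union> T) - w)"
    proof (rule Suc.IH)
      show "0 < prob A'"
        using big by (smt (verit) divide_pos_pos exp_gt_zero)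
      show "exp (- (\<theta> * card (I (Suc 0)))) \<le> prob A'" if "0 < d"
      proof -
        have "L * n \<le> card (I (Suc 0))" using lac[of 0] that by (simp add: n_def)
        from growth[OF I0(3) this] big show ?thesis by linarith
      qed
    next
      fix T x assume T: "T \<subseteq> (\<Union>k<d. I (Suc k))" and x: "x \<in> A'"
      have "rsum (I 0) (S \<union> T) = rsum (I 0) S"
        using T dU by (intro rsum_cong) (auto simp: U_def)
      moreover have "rsum (I (Suc k)) (S \<union> T) = rsum (I (Suc k)) T" if "k < d" for k
        using S dU that by (intro rsum_cong) (auto simp: U_def)
      moreover have "(\<Sum>k<Suc d. b k * rsum (I k) (S \<union> T) x) \<le> g (S \<union> T)"
        using S T x A' unfolding U_def[symmetric] by (intro g) (auto simp: UI simp del: UN_insert)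
      ultimately show "(\<Sum>k<d. b (Suc k) * rsum (I (Suc k)) T x) \<le> g (S \<union> T) - w"
        using w[OF x] unfolding sum.lessThan_Suc_shift by simp
    qed (use blocks disj lac A' A v' in auto)
    then show ?thesis
      using finU by (simp add: U_def tl_def cube_mean_diff)
  qed
  \<comment> \<open>On a substantial part of any half of \<open>A\<close> the signed sum of the first block is negligible.\<close>
  have calm: "exp (- (\<theta> * n)) / 4 \<le> prob {x \<in> A'. \<bar>rsum (I 0) S x\<bar> \<le> \<epsilon> * n}"
    if A': "A' \<in> sets M" "prob A / 2 \<le> prob A'" for A' S
  proof -
    have "prob A' \<le> prob ({x \<in> A'. \<bar>rsum (I 0) S x\<bar> \<le> \<epsilon> * n} \<union> {x \<in> space M. \<epsilon> * n < \<bar>rsum (I 0) S x\<bar>})"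
      using A' sets.sets_into_space[OF A'(1)] meas_sub[OF A'(1), of "\<lambda>t. \<bar>t\<bar> \<le> \<epsilon> * n" S]
      by (intro finite_measure_mono) auto
    also have "\<dots> \<le> prob {x \<in> A'. \<bar>rsum (I 0) S x\<bar> \<le> \<epsilon> * n} + prob {x \<in> space M. \<epsilon> * n < \<bar>rsum (I 0) S x\<bar>}"
      using A' meas_sub[OF A'(1), of "\<lambda>t. \<bar>t\<bar> \<le> \<epsilon> * n" S] by (intro measure_Un_le) auto
    also have "prob {x \<in> space M. \<epsilon> * n < \<bar>rsum (I 0) S x\<bar>} \<le> exp (- (\<theta> * n)) / 4"
      using rsum_tail[OF I0(1,2) I0ne const(3), of S] tail[OF I0(3)] by (simp add: n_def)
    finally show ?thesis using A'(2) big_A by linarith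
  qed
  have total: "(\<Sum>k<Suc d. b k * card (I k)) = b 0 * n + tl"
    unfolding sum.lessThan_Suc_shift by (simp add: n_def tl_def)
  have v_split: "v \<le> b 0 * n * indicator (energetic (I 0)) x
      + (\<Sum>k<d. b (Suc k) * card (I (Suc k)) * indicator (energetic (I (Suc k))) x)" if "x \<in> A" for x
    using v[OF that] unfolding sum.lessThan_Suc_shift by (simp add: n_def)
  have mean: "cube_mean (\<Union>k<Suc d. I k) g = cube_mean (I 0) (\<lambda>S. cube_mean U (\<lambda>T. g (S \<union> T)))"
    unfolding UI using dU I0 finU by (intro cube_mean_Un)
  have calm_w: "- (\<epsilon> * (b 0 * n)) \<le> b 0 * rsum (I 0) S x" if "\<bar>rsum (I 0) S x\<bar> \<le> \<epsilon> * n" for S x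
    using mult_left_mono[of "- (\<epsilon> * n)" "rsum (I 0) S x" "b 0"] that I0(4) by (simp add: abs_le_iff algebra_simps)
  show ?case
  proof (cases "prob A / 2 \<le> prob (A - energetic (I 0))")
    case True
    have "cube_mean (I 0) (\<lambda>S. q * c * v + - (\<epsilon> * (b 0 * n)) - \<epsilon> * tl) \<le> cube_mean (\<Union>k<Suc d. I k) g"
      unfolding mean
    proof (intro cube_mean_mono)
      fix S assume S: "S \<subseteq> I 0"
      show "q * c * v + - (\<epsilon> * (b 0 * n)) - \<epsilon> * tl \<le> cube_mean U (\<lambda>T. g (S \<union> T))"
      proof (rule step[OF S])
        show "{x \<in> A - energetic (I 0). \<bar>rsum (I 0) S x\<bar> \<le> \<epsilon> * n} \<in> sets M"
          by (rule meas_sub) auto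
      qed (use calm[OF _ True] v_split calm_w in fastforce)+
    qed
    then show ?thesis
      unfolding total using I0(1) by (simp add: algebra_simps)
  next
    case False
    have "A \<inter> energetic (I 0) \<inter> (A - energetic (I 0)) = {}" by auto
    then have half: "prob A / 2 \<le> prob (A \<inter> energetic (I 0))"
      using False finite_measure_Union[of "A \<inter> energetic (I 0)" "A - energetic (I 0)"]
      by (simp add: Int_Diff_Un)
    define G where "G = {S\<in>Pow (I 0). exp (- (K * n)) \<le> prob {x\<in>A \<inter> energetic (I 0). c * n \<le> rsum (I 0) S x}}"
    have G: "q \<le> card G / 2 ^ card (I 0)"
      using block[OF I0(1,2), of "A \<inter> energetic (I 0)"] I0(3) half big_A
      by (simp add: n_def G_def field_simps)
    have v1: "v - b 0 * n \<le> (\<Sum>k<d. b (Suc k) * card (I (Suc k)) * indicator (energetic (I (Suc k))) x)"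
      if "x \<in> A \<inter> energetic (I 0)" for x
      using v_split[of x] that by simp
    have "cube_mean (I 0) (\<lambda>S. q * c * (v - b 0 * n) - \<epsilon> * (b 0 * n) - \<epsilon> * tl + c * (b 0 * n) * indicator G S)
        \<le> cube_mean (\<Union>k<Suc d. I k) g"
      unfolding mean
    proof (intro cube_mean_mono)
      fix S assume S: "S \<subseteq> I 0"
      show "q * c * (v - b 0 * n) - \<epsilon> * (b 0 * n) - \<epsilon> * tl + c * (b 0 * n) * indicator G S
          \<le> cube_mean U (\<lambda>T. g (S \<union> T))"
      proof (cases "S \<in> G")
        case True
        have "q * c * (v - b 0 * n) + c * (b 0 * n) - \<epsilon> * tl \<le> cube_mean U (\<lambda>T. g (S \<union> T))"
        proof (rule step[OF S])
          show "{x \<in> A \<inter> energetic (I 0). c * n \<le> rsum (I 0) S x} \<in> sets M"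
            by (rule meas_sub) auto
          show "c * (b 0 * n) \<le> b 0 * rsum (I 0) S x"
            if "x \<in> {x \<in> A \<inter> energetic (I 0). c * n \<le> rsum (I 0) S x}" for x
            using mult_left_mono[of "c * n" "rsum (I 0) S x" "b 0"] that I0(4) by (simp add: algebra_simps)
        qed (use True v1 in \<open>auto simp: G_def\<close>)
        moreover have "0 \<le> \<epsilon> * (b 0 * n)" using const I0 by simp
        ultimately show ?thesis using True by simp
      next
        case False
        have "q * c * (v - b 0 * n) + - (\<epsilon> * (b 0 * n)) - \<epsilon> * tl \<le> cube_mean U (\<lambda>T. g (S \<union> T))"
        proof (rule step[OF S])
          show "{x \<in> A \<inter> energetic (I 0). \<bar>rsum (I 0) S x\<bar> \<le> \<epsilon> * n} \<in> sets M"
            by (rule meas_sub) auto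
        qed (use calm[OF _ half] v1 calm_w in auto)
        with False show ?thesis by simp
      qed
    qed
    also have "cube_mean (I 0) (\<lambda>S. q * c * (v - b 0 * n) - \<epsilon> * (b 0 * n) - \<epsilon> * tl + c * (b 0 * n) * indicator G S)
        = q * c * (v - b 0 * n) - \<epsilon> * (b 0 * n) - \<epsilon> * tl + c * (b 0 * n) * (card G / 2 ^ card (I 0))"
    proof -
      have "cube_mean (I 0) (indicator G) = card G / 2 ^ card (I 0)"
        unfolding cube_mean_def using I0(1)
        by (simp add: indicator_def sum.If_cases G_def Int_def)
      then show ?thesis
        using I0(1) by (simp add: cube_mean_add cube_mean_cmult)
    qed
    finally have "q * c * (v - b 0 * n) - \<epsilon> * (b 0 * n) - \<epsilon> * tl + c * (b 0 * n) * (card G / 2 ^ card (I 0))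
        \<le> cube_mean (\<Union>k<Suc d. I k) g" .
    moreover have "c * (b 0 * n) * q \<le> c * (b 0 * n) * (card G / 2 ^ card (I 0))"
      using G const I0 by (intro mult_left_mono) auto
    ultimately show ?thesis
      unfolding total by (simp add: algebra_simps)
  qed
qed

text \<open>On average the blocks with energy carry at least the fraction \<open>2 * v0\<close> of the total weight \<open>P\<close>, so the
  chain can start from the set where they carry at least \<open>v0 * P\<close>, whose measure is at least \<open>v0\<close>.\<close>

theorem lacunary_rademacher_sidon:
  obtains c :: real and N L :: nat
  where "0 < c" "0 < N" "2 \<le> L"
    and "\<And>(d :: nat) I b g.
      (\<And>k. k < d \<Longrightarrow> finite (I k) \<and> I k \<subseteq> J \<and> N \<le> card (I k) \<and> (0::real) \<le> b k) \<Longrightarrow>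
      (\<And>k l. k < d \<Longrightarrow> l < d \<Longrightarrow> k \<noteq> l \<Longrightarrow> I k \<inter> I l = {}) \<Longrightarrow>
      (\<And>k. Suc k < d \<Longrightarrow> L * card (I k) \<le> card (I (Suc k))) \<Longrightarrow>
      (\<And>S x. S \<subseteq> (\<Union>k<d. I k) \<Longrightarrow> x \<in> \<Omega>0 \<Longrightarrow> (\<Sum>k<d. b k * rsum (I k) S x) \<le> g S) \<Longrightarrow>
      c * (\<Sum>k<d. b k * card (I k)) \<le> cube_mean (\<Union>k<d. I k) g"
proof -
  obtain c0 q \<kappa> K N0 :: real where const: "0 < c0" "0 < q" "0 < \<kappa>" "0 < K"
    and block: "\<And>I A. finite I \<Longrightarrow> I \<subseteq> J \<Longrightarrow> N0 \<le> card I \<Longrightarrow> A \<in> sets M \<Longrightarrow> A \<subseteq> energetic I \<Longrightarrow>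
      8 * exp (- (\<kappa> * card I)) \<le> prob A \<Longrightarrow>
      q * 2 ^ card I \<le> card {S\<in>Pow I. exp (- (K * card I)) \<le> prob {x\<in>A. c0 * card I \<le> rsum I S x}}"
    using block_constants by blast
  define v0 where "v0 = 1 / (8 * B\<^sup>2)"
  \<comment> \<open>The gain of the chain is \<open>q * c0 * v0 * P\<close>; half of it pays for the blocks without gain.\<close>
  define \<epsilon> where "\<epsilon> = q * c0 * v0 / 2"
  have v0: "0 < v0" "v0 \<le> 1" and \<epsilon>: "0 < \<epsilon>"
    using B_ge_1 const one_le_power[of B 2] by (simp_all add: v0_def \<epsilon>_def del: one_le_power)
  \<comment> \<open>Half of each available exponent; the other half absorbs the constant factors for large blocks.\<close>
  define \<theta> where "\<theta> = min (\<kappa> / 2) (\<epsilon>\<^sup>2 / (2 * D))"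
  have \<theta>: "0 < \<theta>" "2 * \<theta> \<le> \<kappa>" "2 * \<theta> \<le> \<epsilon>\<^sup>2 / D"
    using const \<epsilon> D_pos by (auto simp: \<theta>_def min_def field_simps)
  define N where "N = nat \<lceil>max 1 (max N0 (max (ln 16 / \<theta>) (ln (1 / v0) / \<theta>)))\<rceil>"
  have N: "1 \<le> real N" "N0 \<le> real N" "ln 16 / \<theta> \<le> real N" "ln (1 / v0) / \<theta> \<le> real N"
    unfolding N_def by linarith+
  define L where "L = nat \<lceil>max 2 (K / \<theta>)\<rceil>"
  have L: "2 \<le> real L" "K / \<theta> \<le> real L"
    unfolding L_def by linarith+
  have decay: "exp (- (2 * \<theta> * n)) \<le> exp (- (\<theta> * n)) / 16" if "real N \<le> n" for n :: real
  proof -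
    have "ln 16 \<le> \<theta> * real N"
      using N(3) \<theta>(1) by (simp add: pos_divide_le_eq mult.commute)
    also have "\<dots> \<le> \<theta> * n"
      using that \<theta>(1) by (intro mult_left_mono) auto
    finally have "ln 16 \<le> \<theta> * n" .
    then have "16 \<le> exp (\<theta> * n)"
      by (metis exp_le_cancel_iff exp_ln zero_less_numeral)
    then have "exp (- (\<theta> * n)) * exp (- (\<theta> * n)) \<le> exp (- (\<theta> * n)) * (1 / 16)"
      by (intro mult_left_mono) (auto simp: exp_minus field_simps)
    then show ?thesis by (simp add: mult.assoc flip: exp_add)
  qed
  have block': "q * 2 ^ card I
      \<le> card {S\<in>Pow I. exp (- (K * card I)) \<le> prob {x\<in>A. c0 * card I \<le> rsum I S x}}"
    if I: "finite I" "I \<subseteq> J" "real N \<le> card I" "A \<in> sets M" "A \<subseteq> energetic I"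
      and A: "exp (- (\<theta> * card I)) / 2 \<le> prob A" for I A
  proof (rule block)
    have "exp (- (\<kappa> * card I)) \<le> exp (- (2 * \<theta> * card I))"
      using mult_right_mono[OF \<theta>(2), of "card I"] by simp
    with decay[OF I(3)] A show "8 * exp (- (\<kappa> * card I)) \<le> prob A" by linarith
  qed (use I N(2) in auto)
  have tail: "2 * exp (- (\<epsilon>\<^sup>2 * n / D)) \<le> exp (- (\<theta> * n)) / 4" if n: "real N \<le> n" for n :: real
  proof -
    have "exp (- (\<epsilon>\<^sup>2 * n / D)) \<le> exp (- (2 * \<theta> * n))"
      using mult_right_mono[OF \<theta>(3), of n] n N(1) by simp
    with decay[OF n] exp_ge_zero[of "- (\<theta> * n)"] show ?thesis by linarith
  qed
  have growth: "exp (- (\<theta> * n')) \<le> exp (- (K * n)) \<and> exp (- (\<theta> * n')) \<le> exp (- (\<theta> * n)) / 4"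
    if n: "real N \<le> n" "real L * n \<le> n'" for n n' :: real
  proof
    have n0: "0 \<le> n" using n N(1) by linarith
    have "K * n \<le> \<theta> * (real L * n)"
      using mult_right_mono[OF L(2), of "\<theta> * n"] n0 \<theta>(1) by (simp add: algebra_simps)
    also have "\<dots> \<le> \<theta> * n'" using n \<theta> by (intro mult_left_mono) auto
    finally show "exp (- (\<theta> * n')) \<le> exp (- (K * n))" by simp
    have "2 * n \<le> n'" using mult_right_mono[OF L(1) n0] n by linarith
    then have "exp (- (\<theta> * n')) \<le> exp (- (2 * \<theta> * n))"
      using \<theta>(1) mult_left_mono[of "2 * n" n' \<theta>] by (simp add: algebra_simps)
    with decay[OF n(1)] exp_ge_zero[of "- (\<theta> * n)"]
    show "exp (- (\<theta> * n')) \<le> exp (- (\<theta> * n)) / 4" by linarith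
  qed
  show ?thesis
  proof (rule that[of \<epsilon> N L])
    fix d :: nat and I :: "nat \<Rightarrow> 'i set" and b :: "nat \<Rightarrow> real" and g :: "'i set \<Rightarrow> real"
    assume blocks: "\<And>k. k < d \<Longrightarrow> finite (I k) \<and> I k \<subseteq> J \<and> N \<le> card (I k) \<and> 0 \<le> b k"
      and disj: "\<And>k l. k < d \<Longrightarrow> l < d \<Longrightarrow> k \<noteq> l \<Longrightarrow> I k \<inter> I l = {}"
      and lac: "\<And>k. Suc k < d \<Longrightarrow> L * card (I k) \<le> card (I (Suc k))"
      and g: "\<And>S x. S \<subseteq> (\<Union>k<d. I k) \<Longrightarrow> x \<in> \<Omega>0 \<Longrightarrow> (\<Sum>k<d. b k * rsum (I k) S x) \<le> g S"
    define p where "p k = b k * card (I k)" for k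
    define P where "P = (\<Sum>k<d. p k)"
    define V where "V x = (\<Sum>k<d. p k * indicator (energetic (I k)) x)" for x
    define A where "A = {x \<in> \<Omega>0. v0 * P \<le> V x}"
    have p: "k < d \<Longrightarrow> 0 \<le> p k" for k using blocks by (simp add: p_def)
    have P: "0 \<le> P" unfolding P_def using p by (intro sum_nonneg) auto
    have en [measurable]: "k < d \<Longrightarrow> energetic (I k) \<in> sets M" for k
      using blocks by (intro energetic_measurable) auto
    have [measurable]: "V \<in> borel_measurable M"
      unfolding V_def by (intro borel_measurable_sum borel_measurable_times borel_measurable_const borel_measurable_indicator en) auto
    have "A = \<Omega>0 \<inter> {x \<in> space M. v0 * P \<le> V x}"
      using sets.sets_into_space[OF \<Omega>0(1)] by (auto simp: A_def)
    then have A: "A \<in> sets M" using \<Omega>0 by simp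
    have V_le: "V x \<le> P" for x
      unfolding V_def P_def using p by (intro sum_mono) (auto simp: indicator_def)
    have "v0 \<le> prob A"
    proof (cases "P = 0")
      case True
      then have "A = \<Omega>0"
        using p by (auto simp: A_def V_def intro!: sum_nonneg)
      then show ?thesis using \<Omega>0 v0 by simp
    next
      case False
      have "2 * v0 * P \<le> (\<Sum>k<d. p k * prob (energetic (I k)))"
        unfolding P_def sum_distrib_left
      proof (intro sum_mono)
        fix k assume k: "k \<in> {..<d}"
        then have "I k \<noteq> {}" using blocks[of k] N(1) by auto
        then have "2 * v0 \<le> prob (energetic (I k))"
          using prob_energetic[of "I k"] blocks[of k] k by (simp add: v0_def)
        then show "2 * v0 * p k \<le> p k * prob (energetic (I k))"
          using mult_left_mono[of "2 * v0" "prob (energetic (I k))" "p k"] p[of k] k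
          by (simp add: mult.commute)
      qed
      also have "\<dots> = (LINT x|M. V x)"
        unfolding V_def
        by (subst Bochner_Integration.integral_sum) (auto simp: emeasure_eq_measure en)
      also have "\<dots> \<le> (LINT x|M. v0 * P + P * indicator A x)"
      proof (rule integral_mono_AE)
        show "integrable M V"
          unfolding V_def by (intro Bochner_Integration.integrable_sum integrable_mult_right)
            (auto simp: emeasure_eq_measure en)
        show "integrable M (\<lambda>x. v0 * P + P * indicator A x)"
          using A by (auto intro!: integrable_mult_right simp: emeasure_eq_measure)
        show "AE x in M. V x \<le> v0 * P + P * indicator A x"
          using AE_\<Omega>0
        proof eventually_elim
          case (elim x)
          show ?case
            using V_le[of x] elim v0 P by (cases "x \<in> A") (auto simp: A_def add_increasing)
        qed
      qed
      also have "\<dots> = v0 * P + P * prob A"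
        using A by (simp add: prob_space emeasure_eq_measure)
      finally have "v0 * P \<le> prob A * P" by (simp add: algebra_simps)
      then show ?thesis using False P by simp
    qed
    have "exp (- (\<theta> * card (I 0))) \<le> v0" if "0 < d"
    proof -
      have "real N \<le> card (I 0)" using blocks[OF that] by simp
      have "ln (1 / v0) \<le> \<theta> * real N"
        using N(4) \<theta>(1) by (simp add: pos_divide_le_eq mult.commute)
      also have "\<dots> \<le> \<theta> * card (I 0)"
        using \<open>real N \<le> card (I 0)\<close> \<theta>(1) by (intro mult_left_mono) auto
      finally have "- (\<theta> * card (I 0)) \<le> ln v0"
        using v0 by (simp add: ln_div)
      then show ?thesis
        using v0 by (metis exp_le_cancel_iff exp_ln)
    qed
    have "q * c0 * (v0 * P) - \<epsilon> * (\<Sum>k<d. b k * card (I k)) \<le> cube_mean (\<Union>k<d. I k) g"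
    proof (rule lacunary_chain[where c = c0 and q = q and \<epsilon> = \<epsilon> and \<theta> = \<theta> and K = K and N = N and L = L and A = A])
      show "0 < d \<Longrightarrow> exp (- (\<theta> * card (I 0))) \<le> prob A"
        using \<open>0 < d \<Longrightarrow> exp (- (\<theta> * card (I 0))) \<le> v0\<close> \<open>v0 \<le> prob A\<close> by linarith
      show "v0 * P \<le> (\<Sum>k<d. b k * card (I k) * indicator (energetic (I k)) x)" if "x \<in> A" for x
        using that by (simp add: A_def V_def p_def)
      show "real L * card (I k) \<le> card (I (Suc k))" if "Suc k < d" for k
        using lac[OF that] by (simp flip: of_nat_mult)
      show "A \<subseteq> \<Omega>0" by (auto simp: A_def)
      then show "(\<Sum>k<d. b k * rsum (I k) S x) \<le> g S" if "S \<subseteq> (\<Union>k<d. I k)" "x \<in> A" for S x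
        using that by (intro g) auto
      show "finite (I k) \<and> I k \<subseteq> J \<and> real N \<le> card (I k) \<and> 0 \<le> b k" if "k < d" for k
        using blocks[OF that] by simp
      show "0 < prob A" "0 \<le> c0" "0 \<le> q" "0 \<le> \<epsilon>" "0 < real N"
        using v0 \<open>v0 \<le> prob A\<close> const \<epsilon> N by linarith+
      show "I k \<inter> I l = {}" if "k < d" "l < d" "k \<noteq> l" for k l
        using that by (rule disj)
    qed (rule block' tail growth A; assumption)+
    then show "\<epsilon> * (\<Sum>k<d. b k * card (I k)) \<le> cube_mean (\<Union>k<d. I k) g"
      by (simp add: P_def p_def \<epsilon>_def mult.assoc mult.left_commute)
  qed (use \<epsilon> N L in auto)
qed

end

section \<open>Condensing weights to lacunary blocks\<close>

text \<open>Cauchy condensation for a decreasing sequence: the terms between two consecutive cuts \<open>N * L ^ k\<close> are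
  at most the last term before the first of them, and there are \<open>L\<close> times as many of them as in the
  preceding block.\<close>

lemma sum_lacunary_condensation:
  fixes \<alpha> :: "nat \<Rightarrow> real" and N L :: nat
  assumes anti: "\<And>i j. i \<le> j \<Longrightarrow> \<alpha> j \<le> \<alpha> i" and pos: "0 < N" "0 < L"
  shows "(\<Sum>i<N * L ^ Suc d. \<alpha> i)
    \<le> N * L * \<alpha> 0 + L * (\<Sum>k<d. \<alpha> (N * L ^ Suc k - 1) * (real (N * L ^ Suc k) - real (N * L ^ k)))"
proof (induction d)
  case 0
  have "(\<Sum>i<N * L. \<alpha> i) \<le> (\<Sum>i<N * L. \<alpha> 0)"
    by (intro sum_mono anti) auto
  then show ?case by simp
next
  case (Suc d)
  let ?s = "\<lambda>k. N * L ^ k"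
  have "(\<Sum>i<?s (Suc (Suc d)). \<alpha> i) = (\<Sum>i<?s (Suc d). \<alpha> i) + (\<Sum>i=?s (Suc d)..<?s (Suc (Suc d)). \<alpha> i)"
  proof -
    have "?s (Suc d) \<le> ?s (Suc (Suc d))" using pos by simp
    then show ?thesis
      unfolding lessThan_atLeast0 by (intro sum.atLeastLessThan_concat[symmetric]) auto
  qed
  also have "(\<Sum>i=?s (Suc d)..<?s (Suc (Suc d)). \<alpha> i)
      \<le> (\<Sum>i=?s (Suc d)..<?s (Suc (Suc d)). \<alpha> (?s (Suc d) - 1))"
    by (intro sum_mono anti) auto
  also have "\<dots> = L * (\<alpha> (?s (Suc d) - 1) * (real (?s (Suc d)) - real (?s d)))"
    using pos by (simp add: of_nat_diff) (simp add: algebra_simps)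
  finally show ?case
    using Suc.IH by (simp add: algebra_simps)
qed

lemma lacunary_blocks:
  fixes a :: "'i \<Rightarrow> real" and m :: real and N L :: nat
  assumes F: "finite F" and a: "\<And>j. j \<in> F \<Longrightarrow> 0 \<le> a j" "\<And>j. j \<in> F \<Longrightarrow> a j \<le> m" "0 \<le> m"
    and NL: "0 < N" "2 \<le> L"
  obtains d :: nat and I :: "nat \<Rightarrow> 'i set" and b :: "nat \<Rightarrow> real"
  where "\<And>k. k < d \<Longrightarrow> finite (I k) \<and> I k \<subseteq> F \<and> N \<le> card (I k) \<and> 0 \<le> b k"
    and "\<And>k j. k < d \<Longrightarrow> j \<in> I k \<Longrightarrow> b k \<le> a j"
    and "\<And>k l. k < d \<Longrightarrow> l < d \<Longrightarrow> k \<noteq> l \<Longrightarrow> I k \<inter> I l = {}"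
    and "\<And>k. Suc k < d \<Longrightarrow> L * card (I k) \<le> card (I (Suc k))"
    and "(\<Sum>j\<in>F. a j) \<le> N * L * m + L * (\<Sum>k<d. b k * card (I k))"
proof -
  obtain xs where xs: "set xs = F" "distinct xs"
    using finite_distinct_list[OF F] by blast
  define ys where "ys = sort_key (\<lambda>j. - a j) xs"
  define n where "n = length ys"
  have ys: "set ys = F" "distinct ys" "sorted (map (\<lambda>j. - a j) ys)"
    using xs by (simp_all add: ys_def)
  define \<alpha> where "\<alpha> i = (if i < n then a (ys ! i) else 0)" for i
  define s where "s k = N * L ^ k" for k
  \<comment> \<open>The complete blocks; the entries after them are covered by the condensation estimate.\<close>
  define d where "d = (LEAST d. n < s (Suc d))"
  define I where "I k = (!) ys ` {s k..<s (Suc k)}" for k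
  define b where "b k = \<alpha> (s (Suc k) - 1)" for k
  have ys_F: "i < n \<Longrightarrow> ys ! i \<in> F" for i
    using ys(1) by (auto simp: n_def)
  have \<alpha>_nonneg: "0 \<le> \<alpha> i" for i
    using a(1) ys_F by (simp add: \<alpha>_def)
  have anti: "\<alpha> j \<le> \<alpha> i" if "i \<le> j" for i j
    using sorted_nth_mono[OF ys(3) that] that \<alpha>_nonneg[of i]
    by (auto simp: \<alpha>_def n_def)
  have "n < s (Suc n)"
  proof -
    have "n < 2 ^ n" by (rule less_exp)
    also have "\<dots> \<le> L ^ Suc n" using NL by (intro order_trans[OF power_mono[of 2 L n]] power_increasing) auto
    also have "\<dots> \<le> s (Suc n)" using NL by (simp add: s_def)
    finally show ?thesis .
  qed
  then have n_less: "n < s (Suc d)"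
    unfolding d_def by (rule LeastI)
  have s_le: "s (Suc k) \<le> n" if "k < d" for k
    using not_less_Least[of k "\<lambda>d. n < s (Suc d)"] that by (simp add: d_def)
  have s_mono: "s k \<le> s l" if "k \<le> l" for k l
    using that NL by (simp add: s_def power_increasing)
  have inj: "inj_on ((!) ys) {..<n}"
    using ys(2) by (simp add: inj_on_nth n_def)
  have card_I: "card (I k) = s (Suc k) - s k" if "k < d" for k
  proof -
    have "{s k..<s (Suc k)} \<subseteq> {..<n}" using s_le[OF that] by auto
    then show ?thesis
      unfolding I_def by (subst card_image[OF inj_on_subset[OF inj]]) auto
  qed
  have diff: "s (Suc k) - s k = N * L ^ k * (L - 1)" for k
    by (simp add: s_def algebra_simps diff_mult_distrib2)
  show ?thesis
  proof (rule that[of d I b])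
    fix k assume k: "k < d"
    have "N * 1 \<le> N * (L ^ k * (L - 1))" using NL by (intro mult_left_mono) auto
    then show "finite (I k) \<and> I k \<subseteq> F \<and> N \<le> card (I k) \<and> 0 \<le> b k"
      using s_le[OF k] card_I[OF k] ys_F \<alpha>_nonneg by (auto simp: I_def b_def diff mult.assoc)
  next
    fix k j assume k: "k < d" and "j \<in> I k"
    then obtain i where i: "j = ys ! i" "i < s (Suc k)" by (auto simp: I_def)
    then have "b k \<le> \<alpha> i" unfolding b_def by (intro anti) auto
    also have "\<alpha> i = a j" using i s_le[OF k] by (simp add: \<alpha>_def)
    finally show "b k \<le> a j" .
  next
    have disj: "I k \<inter> I l = {}" if "k < l" "l < d" for k l
    proof -
      have "{s k..<s (Suc k)} \<inter> {s l..<s (Suc l)} = {}"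
        using s_mono[of "Suc k" l] that by auto
      moreover have "{s k..<s (Suc k)} \<subseteq> {..<n}" "{s l..<s (Suc l)} \<subseteq> {..<n}"
        using s_le[of k] s_le[of l] that by auto
      ultimately show ?thesis
        unfolding I_def by (subst inj_on_image_Int[OF inj, symmetric]) auto
    qed
    fix k l assume "k < d" "l < d" "k \<noteq> l"
    then show "I k \<inter> I l = {}"
      using disj[of k l] disj[of l k] by (cases "k < l") auto
  next
    fix k assume "Suc k < d"
    then show "L * card (I k) \<le> card (I (Suc k))"
      by (simp add: card_I diff mult_ac)
  next
    have "(\<Sum>j\<in>F. a j) = (\<Sum>i<n. \<alpha> i)"
    proof -
      have "F = (!) ys ` {..<n}"
        using ys(1) by (auto simp: n_def set_conv_nth)
      then show ?thesis
        by (simp add: sum.reindex[OF inj] \<alpha>_def)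
    qed
    also have "\<dots> \<le> (\<Sum>i<s (Suc d). \<alpha> i)"
      using n_less \<alpha>_nonneg by (intro sum_mono2) auto
    also have "\<dots> \<le> N * L * \<alpha> 0 + L * (\<Sum>k<d. \<alpha> (s (Suc k) - 1) * (real (s (Suc k)) - real (s k)))"
      unfolding s_def using sum_lacunary_condensation[of \<alpha> N L d] anti NL by (simp add: mult.assoc)
    also have "(\<Sum>k<d. \<alpha> (s (Suc k) - 1) * (real (s (Suc k)) - real (s k))) = (\<Sum>k<d. b k * card (I k))"
      using s_mono by (intro sum.cong) (auto simp: b_def card_I of_nat_diff)
    also have "N * L * \<alpha> 0 \<le> N * L * m"
      using a ys_F by (intro mult_left_mono) (auto simp: \<alpha>_def)
    finally show "(\<Sum>j\<in>F. a j) \<le> N * L * m + L * (\<Sum>k<d. b k * card (I k))" by simp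
  qed
qed

section \<open>Duality with Riesz products\<close>

lemma sum_Pow_by_card:
  fixes f :: "'i set \<Rightarrow> 'b::comm_monoid_add"
  assumes "finite U"
  shows "(\<Sum>S\<in>Pow U. f S) = f {} + ((\<Sum>i\<in>U. f {i}) + (\<Sum>S | S \<subseteq> U \<and> 2 \<le> card S. f S))"
proof -
  let ?H = "{S. S \<subseteq> U \<and> 2 \<le> card S}"
  have "Pow U = insert {} ((\<lambda>i. {i}) ` U \<union> ?H)"
  proof (intro equalityI subsetI)
    fix S assume S: "S \<in> Pow U"
    then have fin: "finite S" using assms finite_subset by blast
    consider "card S = 0" | "card S = 1" | "2 \<le> card S" by linarith
    then show "S \<in> insert {} ((\<lambda>i. {i}) ` U \<union> ?H)"
    proof cases
      case 1 with fin show ?thesis by simp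
    next
      case 2
      then obtain i where "S = {i}" by (rule card_1_singletonE)
      with S show ?thesis by simp
    next
      case 3 with S show ?thesis by simp
    qed
  qed auto
  moreover have fin: "finite ?H" using assms by simp
  moreover have "{} \<notin> (\<lambda>i. {i}) ` U \<union> ?H" by auto
  moreover have "(\<Sum>S\<in>(\<lambda>i. {i}) ` U \<union> ?H. f S) = (\<Sum>S\<in>(\<lambda>i. {i}) ` U. f S) + (\<Sum>S\<in>?H. f S)"
    using assms fin by (intro sum.union_disjoint) auto
  moreover have "(\<Sum>S\<in>(\<lambda>i. {i}) ` U. f S) = (\<Sum>i\<in>U. f {i})"
    by (simp add: sum.reindex)
  ultimately show ?thesis
    using assms by simp
qed

lemma orthonormal_system_integrable:
  assumes "orthonormal_system M J \<phi>" "i \<in> J" "j \<in> J"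
  shows "integrable M (\<lambda>x. \<phi> i x * cnj (\<phi> j x))"
proof (rule Bochner_Integration.integrable_bound)
  have meas: "\<phi> i \<in> borel_measurable M" "\<phi> j \<in> borel_measurable M"
    using assms by (auto simp: orthonormal_system_def)
  show "integrable M (\<lambda>x. (cmod (\<phi> i x))\<^sup>2 + (cmod (\<phi> j x))\<^sup>2)"
    using assms by (intro Bochner_Integration.integrable_add) (auto simp: orthonormal_system_def)
  have "(\<lambda>x. cnj (\<phi> j x)) \<in> borel_measurable M"
    using meas(2) by (rule measurable_compose) (intro borel_measurable_continuous_onI continuous_intros)
  then show "(\<lambda>x. \<phi> i x * cnj (\<phi> j x)) \<in> borel_measurable M"
    using meas(1) by (rule borel_measurable_times[rotated])
  show "AE x in M. norm (\<phi> i x * cnj (\<phi> j x)) \<le> norm ((cmod (\<phi> i x))\<^sup>2 + (cmod (\<phi> j x))\<^sup>2)"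
  proof (rule AE_I2)
    fix x
    have "0 \<le> (cmod (\<phi> i x) - cmod (\<phi> j x))\<^sup>2" by simp
    then have "2 * (cmod (\<phi> i x) * cmod (\<phi> j x)) \<le> (cmod (\<phi> i x))\<^sup>2 + (cmod (\<phi> j x))\<^sup>2"
      by (simp add: power2_eq_square algebra_simps)
    moreover have "0 \<le> cmod (\<phi> i x) * cmod (\<phi> j x)" by simp
    ultimately have "cmod (\<phi> i x) * cmod (\<phi> j x) \<le> (cmod (\<phi> i x))\<^sup>2 + (cmod (\<phi> j x))\<^sup>2"
      by linarith
    then show "norm (\<phi> i x * cnj (\<phi> j x)) \<le> norm ((cmod (\<phi> i x))\<^sup>2 + (cmod (\<phi> j x))\<^sup>2)"
      by (simp add: norm_mult)
  qed
qed

lemma orthonormal_system_norm: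
  assumes "orthonormal_system M J \<phi>" "j \<in> J"
  shows "(LINT x|M. (cmod (\<phi> j x))\<^sup>2) = 1"
proof -
  have "(LINT x|M. \<phi> j x * cnj (\<phi> j x)) = 1"
    using assms by (auto simp: orthonormal_system_def)
  then have "complex_of_real (LINT x|M. (cmod (\<phi> j x))\<^sup>2) = 1"
    by (simp only: complex_norm_square[symmetric] integral_complex_of_real)
  then show ?thesis by (simp only: of_real_eq_1_iff)
qed

text \<open>The coefficient is the integral of the sum against \<open>cnj (\<phi> j)\<close>, and the mean of \<open>\<bar>\<phi> j\<bar>\<close> is at most
  \<open>1\<close>, being at most the mean of \<open>(1 + \<bar>\<phi> j\<bar>\<^sup>2) / 2\<close>.\<close>

lemma orthonormal_coefficient_le_sup:
  assumes M: "prob_space M" and on: "orthonormal_system M F \<phi>" and F: "finite F" "j \<in> F"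
    and K: "\<And>x. x \<in> space M \<Longrightarrow> cmod (\<Sum>k\<in>F. c k * \<phi> k x) \<le> K"
  shows "cmod (c j) \<le> K"
proof -
  interpret prob_space M by (rule M)
  define f where "f x = (\<Sum>k\<in>F. c k * (\<phi> k x * cnj (\<phi> j x)))" for x
  have sq_int: "integrable M (\<lambda>x. (cmod (\<phi> j x))\<^sup>2)"
    using on F by (auto simp: orthonormal_system_def)
  have sq_one: "(LINT x|M. (cmod (\<phi> j x))\<^sup>2) = 1"
    by (rule orthonormal_system_norm[OF on F(2)])
  have int: "integrable M (\<lambda>x. \<phi> k x * cnj (\<phi> j x))" if "k \<in> F" for k
    using orthonormal_system_integrable[OF on that F(2)] .
  have "(LINT x|M. f x) = (\<Sum>k\<in>F. c k * (LINT x|M. \<phi> k x * cnj (\<phi> j x)))"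
    unfolding f_def using int by simp
  also have "\<dots> = (\<Sum>k\<in>F. if k = j then c j else 0)"
    using on F by (intro sum.cong) (auto simp: orthonormal_system_def)
  also have "\<dots> = c j" using F by simp
  finally have "cmod (c j) = cmod (LINT x|M. f x)" by simp
  also have "\<dots> \<le> (LINT x|M. cmod (f x))" by simp
  also have "\<dots> \<le> (LINT x|M. K * ((1 + (cmod (\<phi> j x))\<^sup>2) / 2))"
  proof (rule integral_mono)
    show "integrable M (\<lambda>x. cmod (f x))"
      unfolding f_def using int by (intro integrable_norm Bochner_Integration.integrable_sum integrable_mult_right)
    show "integrable M (\<lambda>x. K * ((1 + (cmod (\<phi> j x))\<^sup>2) / 2))"
      using sq_int by simp
    fix x assume x: "x \<in> space M"
    have "f x = (\<Sum>k\<in>F. c k * \<phi> k x) * cnj (\<phi> j x)"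
      by (simp add: f_def sum_distrib_right mult.assoc)
    then have "cmod (f x) \<le> K * cmod (\<phi> j x)"
      using K[OF x] by (simp add: norm_mult mult_right_mono)
    also have "\<dots> \<le> K * ((1 + (cmod (\<phi> j x))\<^sup>2) / 2)"
    proof (rule mult_left_mono)
      have "0 \<le> (cmod (\<phi> j x) - 1)\<^sup>2" by simp
      then show "cmod (\<phi> j x) \<le> (1 + (cmod (\<phi> j x))\<^sup>2) / 2"
        by (simp add: power2_eq_square algebra_simps)
      show "0 \<le> K" using K[OF x] by (rule order_trans[OF norm_ge_zero])
    qed
    finally show "cmod (f x) \<le> K * ((1 + (cmod (\<phi> j x))\<^sup>2) / 2)" .
  qed
  also have "\<dots> = K"
    using sq_int by (simp add: sq_one prob_space)
  finally show ?thesis .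
qed

text \<open>The points \<open>X T\<close> are a free choice, and \<open>N0\<close> is any bound for the threefold sum. The set \<open>\<Omega>0\<close> makes the
  essential bounds of the \<open>\<phi> j\<close> pointwise, as is needed at the single points \<open>X T\<close>.\<close>

locale riesz_duality = prob_space M for M :: "'a measure" +
  fixes F U :: "'i set" and \<phi> :: "'i \<Rightarrow> 'a \<Rightarrow> complex" and a :: "'i \<Rightarrow> complex"
    and X :: "'i set \<Rightarrow> 'a" and \<Omega>0 :: "'a set" and B N0 :: real
  assumes F: "finite F" "U \<subseteq> F"
    and orthonormal: "orthonormal_system M F \<phi>"
    and \<Omega>0: "\<Omega>0 \<in> sets M" "prob \<Omega>0 = 1"
    and B: "1 \<le> B" "\<And>j x. j \<in> F \<Longrightarrow> x \<in> \<Omega>0 \<Longrightarrow> cmod (\<phi> j x) \<le> B"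
    and X: "\<And>T. T \<subseteq> U \<Longrightarrow> X T \<in> \<Omega>0"
    and N0: "\<And>x y z. x \<in> space M \<Longrightarrow> y \<in> space M \<Longrightarrow> z \<in> space M \<Longrightarrow>
      cmod (\<Sum>j\<in>F. a j * (\<phi> j x * \<phi> j y * \<phi> j z)) \<le> N0"
begin

definition walsh_coeff :: "'i \<Rightarrow> 'i set \<Rightarrow> complex" where
  "walsh_coeff j S = cube_mean U (\<lambda>T. of_real (walsh S T) * \<phi> j (X T))"

lemma U: "finite U"
  using F finite_subset by blast

lemma walsh_coeff_square_sum: "j \<in> F \<Longrightarrow> (\<Sum>S\<in>Pow U. (cmod (walsh_coeff j S))\<^sup>2) \<le> B\<^sup>2"
proof -
  assume j: "j \<in> F"
  have "(\<Sum>S\<in>Pow U. (cmod (walsh_coeff j S))\<^sup>2) = cube_mean U (\<lambda>T. (cmod (\<phi> j (X T)))\<^sup>2)"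
    unfolding walsh_coeff_def by (rule walsh_parseval[OF U])
  also have "\<dots> \<le> cube_mean U (\<lambda>T. B\<^sup>2)"
    using B X j by (intro cube_mean_mono power_mono) auto
  finally show ?thesis using U by simp
qed

text \<open>The left-hand side is the average of the threefold sum at \<open>X T\<close>, \<open>X T'\<close> and \<open>z\<close> against a Riesz product,
  which is a probability density on pairs of sign vectors.\<close>

lemma riesz_test:
  assumes z: "z \<in> \<Omega>0" and t: "\<And>i. i \<in> U \<Longrightarrow> \<bar>t i\<bar> \<le> 1"
  shows "cmod (\<Sum>j\<in>F. a j * \<phi> j z * (\<Sum>S\<in>Pow U. of_real (\<Prod>i\<in>S. t i) * (walsh_coeff j S)\<^sup>2)) \<le> N0"
proof -
  let ?R = "\<lambda>T T'. \<Prod>i\<in>U. 1 + t i * (sgn_at T i * sgn_at T' i)"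
  let ?\<Psi> = "\<lambda>T T'. \<Sum>j\<in>F. a j * (\<phi> j (X T) * \<phi> j (X T') * \<phi> j z)"
  have R: "0 \<le> ?R T T'" for T T'
  proof (intro prod_nonneg)
    fix i assume "i \<in> U"
    then have "\<bar>t i * (sgn_at T i * sgn_at T' i)\<bar> \<le> 1"
      using t by (simp add: abs_mult)
    then show "0 \<le> 1 + t i * (sgn_at T i * sgn_at T' i)" by linarith
  qed
  have space: "x \<in> \<Omega>0 \<Longrightarrow> x \<in> space M" for x
    using sets.sets_into_space[OF \<Omega>0(1)] by auto
  have "(\<Sum>j\<in>F. a j * \<phi> j z * (\<Sum>S\<in>Pow U. of_real (\<Prod>i\<in>S. t i) * (walsh_coeff j S)\<^sup>2))
      = cube_mean U (\<lambda>T. cube_mean U (\<lambda>T'. of_real (?R T T') * ?\<Psi> T T'))"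
  proof -
    have "a j * \<phi> j z * (\<Sum>S\<in>Pow U. of_real (\<Prod>i\<in>S. t i) * (walsh_coeff j S)\<^sup>2)
        = cube_mean U (\<lambda>T. cube_mean U (\<lambda>T'. of_real (?R T T') * (a j * (\<phi> j (X T) * \<phi> j (X T') * \<phi> j z))))" for j
      unfolding walsh_coeff_def riesz_product_walsh_expansion[OF U, symmetric] cube_mean_cmult[symmetric]
      by (intro cube_mean_cong) (simp add: mult_ac)
    then show ?thesis
      by (simp only: cube_mean_sum sum_distrib_left)
  qed
  also have "cmod \<dots> \<le> cube_mean U (\<lambda>T. cube_mean U (\<lambda>T'. cmod (of_real (?R T T') * ?\<Psi> T T')))"
    by (intro order_trans[OF norm_cube_mean_le] cube_mean_mono norm_cube_mean_le)
  also have "\<dots> \<le> cube_mean U (\<lambda>T. cube_mean U (\<lambda>T'. N0 * ?R T T'))"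
  proof (intro cube_mean_mono)
    fix T T' assume "T \<subseteq> U" "T' \<subseteq> U"
    then have "cmod (?\<Psi> T T') \<le> N0" using X z space by (intro N0) auto
    then show "cmod (of_real (?R T T') * ?\<Psi> T T') \<le> N0 * ?R T T'"
      using R[of T T'] by (simp add: norm_mult mult.commute[of N0] mult_left_mono del: of_real_prod)
  qed
  also have "\<dots> = N0"
  proof -
    have "cube_mean U (\<lambda>T'. ?R T T') = 1" for T
      using cube_mean_prod[OF U, of "\<lambda>i r. 1 + t i * (sgn_at T i * r)"] by simp
    then show ?thesis using U by (simp add: cube_mean_cmult)
  qed
  finally show ?thesis .
qed

text \<open>The real Riesz products for the phases \<open>\<omega>\<close> and \<open>\<i> * \<omega>\<close> combine to the complex linear term
  \<open>\<omega> i * cnj (\<phi> i z)\<close>, since \<open>\<zeta> = Re \<zeta> - \<i> * Re (\<i> * \<zeta>)\<close>; a system that is merely orthonormal gives no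
  control over the integrals of \<open>\<phi> i * \<phi> j\<close>, which \<open>Re\<close> alone would produce. The term of order
  zero is the Riesz product with all parameters \<open>0\<close> and is subtracted.\<close>

lemma linear_part_pointwise:
  fixes \<omega> :: "'i \<Rightarrow> complex" and \<delta> :: real
  assumes z: "z \<in> \<Omega>0" and \<omega>: "\<And>i. cmod (\<omega> i) \<le> 1" and \<delta>: "0 \<le> \<delta>" "\<delta> * B \<le> 1"
  shows "cmod (\<Sum>j\<in>F. \<Sum>i\<in>U. of_real \<delta> * (a j * \<omega> i * (walsh_coeff j {i})\<^sup>2) * (\<phi> j z * cnj (\<phi> i z)))
    \<le> 4 * N0 + 2 * \<delta>\<^sup>2 * B ^ 5 * (\<Sum>j\<in>F. cmod (a j))"
proof -
  define H where "H = {S. S \<subseteq> U \<and> 2 \<le> card S}"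
  define Q where "Q t = (\<Sum>j\<in>F. a j * \<phi> j z * (\<Sum>S\<in>Pow U. of_real (\<Prod>i\<in>S. t i) * (walsh_coeff j S)\<^sup>2))" for t
  define E where "E t = (\<Sum>j\<in>F. a j * \<phi> j z * (\<Sum>S\<in>H. of_real (\<Prod>i\<in>S. t i) * (walsh_coeff j S)\<^sup>2))" for t
  define t where "t i = \<delta> * Re (\<omega> i * cnj (\<phi> i z))" for i
  define t' where "t' i = \<delta> * Re (\<i> * \<omega> i * cnj (\<phi> i z))" for i
  have small: "\<bar>\<delta> * Re (\<zeta> * cnj (\<phi> i z))\<bar> \<le> \<delta> * B" if "cmod \<zeta> \<le> 1" "i \<in> U" for \<zeta> i
  proof -
    have "\<bar>Re (\<zeta> * cnj (\<phi> i z))\<bar> \<le> cmod \<zeta> * cmod (\<phi> i z)"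
      by (metis abs_Re_le_cmod complex_mod_cnj norm_mult)
    also have "\<dots> \<le> 1 * B" using that F B z by (intro mult_mono) auto
    finally show ?thesis using \<delta> by (simp add: abs_mult mult_left_mono)
  qed
  have t: "\<bar>t i\<bar> \<le> \<delta> * B" "\<bar>t' i\<bar> \<le> \<delta> * B" if "i \<in> U" for i
    unfolding t_def t'_def using \<omega>[of i] that by (intro small; simp add: norm_mult)+
  have N0_bounds: "cmod (Q t) \<le> N0" "cmod (Q t') \<le> N0" "cmod (Q (\<lambda>_. 0)) \<le> N0"
    unfolding Q_def using t(1)[THEN order_trans, OF _ \<delta>(2)] t(2)[THEN order_trans, OF _ \<delta>(2)]
    by (intro riesz_test[OF z]; simp)+
  have error: "cmod (E s) \<le> \<delta>\<^sup>2 * B ^ 5 * (\<Sum>j\<in>F. cmod (a j))" if s: "\<And>i. i \<in> U \<Longrightarrow> \<bar>s i\<bar> \<le> \<delta> * B" for s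
  proof -
    have "cmod (\<Sum>S\<in>H. of_real (\<Prod>i\<in>S. s i) * (walsh_coeff j S)\<^sup>2) \<le> \<delta>\<^sup>2 * B ^ 4" if j: "j \<in> F" for j
    proof -
      have "cmod (\<Sum>S\<in>H. of_real (\<Prod>i\<in>S. s i) * (walsh_coeff j S)\<^sup>2) \<le> (\<Sum>S\<in>H. (\<delta> * B)\<^sup>2 * (cmod (walsh_coeff j S))\<^sup>2)"
      proof (intro sum_norm_le)
        fix S assume S: "S \<in> H"
        have "\<bar>\<Prod>i\<in>S. s i\<bar> \<le> (\<Prod>i\<in>S. \<delta> * B)"
          unfolding abs_prod using S s by (intro prod_mono) (auto simp: H_def)
        also have "\<dots> = (\<delta> * B) ^ card S" by simp
        also have "\<dots> \<le> (\<delta> * B)\<^sup>2"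
          using S \<delta> B by (intro power_decreasing) (auto simp: H_def)
        finally show "cmod (of_real (\<Prod>i\<in>S. s i) * (walsh_coeff j S)\<^sup>2) \<le> (\<delta> * B)\<^sup>2 * (cmod (walsh_coeff j S))\<^sup>2"
          by (simp add: norm_mult norm_power mult_right_mono del: of_real_prod)
      qed
      also have "\<dots> \<le> (\<delta> * B)\<^sup>2 * (\<Sum>S\<in>Pow U. (cmod (walsh_coeff j S))\<^sup>2)"
        unfolding sum_distrib_left[symmetric] using U
        by (intro mult_left_mono sum_mono2) (auto simp: H_def)
      also have "\<dots> \<le> (\<delta> * B)\<^sup>2 * B\<^sup>2"
        using walsh_coeff_square_sum[OF j] by (intro mult_left_mono) auto
      finally show ?thesis by (simp add: power_mult_distrib algebra_simps power2_eq_square eval_nat_numeral)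
    qed
    then have "cmod (E s) \<le> (\<Sum>j\<in>F. cmod (a j) * B * (\<delta>\<^sup>2 * B ^ 4))"
      unfolding E_def using B z
      by (intro sum_norm_le) (auto simp: norm_mult intro!: mult_mono)
    then show ?thesis
      by (simp add: sum_distrib_left sum_distrib_right mult_ac eval_nat_numeral)
  qed
  have split: "Q s = Q (\<lambda>_. 0) + (\<Sum>j\<in>F. \<Sum>i\<in>U. a j * \<phi> j z * (of_real (s i) * (walsh_coeff j {i})\<^sup>2)) + E s" for s
  proof -
    have zero: "(\<Sum>S\<in>Pow U. complex_of_real (\<Prod>i\<in>S. 0) * (walsh_coeff j S)\<^sup>2) = (walsh_coeff j {})\<^sup>2" for j
    proof -
      have "(\<Sum>S\<in>Pow U. complex_of_real (\<Prod>i\<in>S. 0) * (walsh_coeff j S)\<^sup>2) = (\<Sum>S\<in>{{}}. complex_of_real (\<Prod>i\<in>S. 0) * (walsh_coeff j S)\<^sup>2)"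
      proof (intro sum.mono_neutral_right ballI)
        fix S assume S: "S \<in> Pow U - {{}}"
        then have "finite S" using U finite_subset by blast
        with S have "(\<Prod>i\<in>S. 0 :: real) = 0"
          by (intro prod_zero) auto
        then show "complex_of_real (\<Prod>i\<in>S. 0) * (walsh_coeff j S)\<^sup>2 = 0"
          by (simp only: of_real_0 mult_zero_left)
      qed (use U in auto)
      then show ?thesis by simp
    qed
    have "a j * \<phi> j z * (\<Sum>S\<in>Pow U. of_real (\<Prod>i\<in>S. s i) * (walsh_coeff j S)\<^sup>2)
        = a j * \<phi> j z * (walsh_coeff j {})\<^sup>2 + (\<Sum>i\<in>U. a j * \<phi> j z * (of_real (s i) * (walsh_coeff j {i})\<^sup>2))
          + a j * \<phi> j z * (\<Sum>S\<in>H. of_real (\<Prod>i\<in>S. s i) * (walsh_coeff j S)\<^sup>2)" for j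
      unfolding sum_Pow_by_card[OF U] H_def
      by (simp add: distrib_left sum_distrib_left add.assoc)
    then show ?thesis
      unfolding Q_def E_def zero by (simp add: sum.distrib)
  qed
  have "(\<Sum>j\<in>F. \<Sum>i\<in>U. of_real \<delta> * (a j * \<omega> i * (walsh_coeff j {i})\<^sup>2) * (\<phi> j z * cnj (\<phi> i z)))
      = (\<Sum>j\<in>F. \<Sum>i\<in>U. a j * \<phi> j z * (of_real (t i) * (walsh_coeff j {i})\<^sup>2))
        - \<i> * (\<Sum>j\<in>F. \<Sum>i\<in>U. a j * \<phi> j z * (of_real (t' i) * (walsh_coeff j {i})\<^sup>2))"
  proof -
    have "of_real (t i) - \<i> * of_real (t' i) = of_real \<delta> * (\<omega> i * cnj (\<phi> i z))" for i
      by (simp add: t_def t'_def complex_eq_iff algebra_simps)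
    then have key: "of_real \<delta> * (a j * \<omega> i * (walsh_coeff j {i})\<^sup>2) * (\<phi> j z * cnj (\<phi> i z))
        = a j * \<phi> j z * (walsh_coeff j {i})\<^sup>2 * (of_real (t i) - \<i> * of_real (t' i))" for i j
      by (simp add: mult_ac)
    show ?thesis
      unfolding sum_distrib_left sum_subtractf[symmetric] key
      by (simp add: algebra_simps)
  qed
  also have "\<dots> = (Q t - Q (\<lambda>_. 0) - E t) - \<i> * (Q t' - Q (\<lambda>_. 0) - E t')"
    using split[of t] split[of t'] by simp
  also have "cmod \<dots> \<le> (cmod (Q t) + cmod (Q (\<lambda>_. 0)) + cmod (E t))
      + (cmod (Q t') + cmod (Q (\<lambda>_. 0)) + cmod (E t'))"
    by (intro order_trans[OF norm_triangle_ineq4] add_mono)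
       (auto simp: norm_mult intro!: order_trans[OF norm_triangle_ineq4] add_mono)
  also have "\<dots> \<le> 4 * N0 + 2 * (\<delta>\<^sup>2 * B ^ 5 * (\<Sum>j\<in>F. cmod (a j)))"
  proof -
    have "cmod (E t) \<le> \<delta>\<^sup>2 * B ^ 5 * (\<Sum>j\<in>F. cmod (a j))"
      and "cmod (E t') \<le> \<delta>\<^sup>2 * B ^ 5 * (\<Sum>j\<in>F. cmod (a j))"
      by (rule error, erule t)+
    with N0_bounds show ?thesis by linarith
  qed
  finally show ?thesis by (simp add: mult.assoc)
qed

text \<open>Integrating over \<open>z\<close> leaves the diagonal terms; \<open>\<omega>\<close> is chosen to make each of them nonnegative. It has
  modulus \<open>0\<close> instead of \<open>1\<close> where the term vanishes.\<close>

theorem diagonal_coefficients: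
  assumes \<delta>: "0 \<le> \<delta>" "\<delta> * B \<le> 1"
  shows "\<delta> * (\<Sum>j\<in>U. cmod (a j) * (cmod (walsh_coeff j {j}))\<^sup>2)
    \<le> 4 * N0 + 2 * \<delta>\<^sup>2 * B ^ 5 * (\<Sum>j\<in>F. cmod (a j))"
proof -
  define \<omega> where "\<omega> i = cnj (sgn (a i * (walsh_coeff i {i})\<^sup>2))" for i
  define f where "f z = (\<Sum>j\<in>F. \<Sum>i\<in>U. of_real \<delta> * (a j * \<omega> i * (walsh_coeff j {i})\<^sup>2) * (\<phi> j z * cnj (\<phi> i z)))" for z
  have \<omega>: "cmod (\<omega> i) \<le> 1" for i
    by (simp add: \<omega>_def norm_sgn)
  have AE0: "AE z in M. z \<in> \<Omega>0"
    using prob_eq_1[OF \<Omega>0(1)] \<Omega>0(2) by simp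
  have int: "integrable M (\<lambda>z. \<phi> j z * cnj (\<phi> i z))" if "j \<in> F" "i \<in> F" for i j
    by (rule orthonormal_system_integrable[OF orthonormal that])
  have f_int: "integrable M f"
    unfolding f_def
    by (intro Bochner_Integration.integrable_sum integrable_mult_right int) (use F in auto)
  have "(LINT z|M. f z) = (\<Sum>j\<in>F. \<Sum>i\<in>U. of_real \<delta> * (a j * \<omega> i * (walsh_coeff j {i})\<^sup>2) * (if j = i then 1 else 0))"
  proof -
    have "(LINT z|M. f z) = (\<Sum>j\<in>F. \<Sum>i\<in>U. LINT z|M. of_real \<delta> * (a j * \<omega> i * (walsh_coeff j {i})\<^sup>2) * (\<phi> j z * cnj (\<phi> i z)))"
      unfolding f_def using F int
      by (subst Bochner_Integration.integral_sum, force)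
         (intro sum.cong refl Bochner_Integration.integral_sum integrable_mult_right, auto)
    also have "\<dots> = (\<Sum>j\<in>F. \<Sum>i\<in>U. of_real \<delta> * (a j * \<omega> i * (walsh_coeff j {i})\<^sup>2) * (if j = i then 1 else 0))"
    proof (intro sum.cong refl)
      fix j i assume "j \<in> F" "i \<in> U"
      then have "(LINT z|M. \<phi> j z * cnj (\<phi> i z)) = (if j = i then 1 else 0)"
        using orthonormal F by (auto simp: orthonormal_system_def)
      then show "(LINT z|M. of_real \<delta> * (a j * \<omega> i * (walsh_coeff j {i})\<^sup>2) * (\<phi> j z * cnj (\<phi> i z)))
          = of_real \<delta> * (a j * \<omega> i * (walsh_coeff j {i})\<^sup>2) * (if j = i then 1 else 0)"
        by (simp only: integral_mult_right_zero)
    qed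
    finally show ?thesis .
  qed
  also have "\<dots> = (\<Sum>j\<in>U. of_real \<delta> * (a j * \<omega> j * (walsh_coeff j {j})\<^sup>2))"
  proof -
    have "(\<Sum>i\<in>U. of_real \<delta> * (a j * \<omega> i * (walsh_coeff j {i})\<^sup>2) * (if j = i then 1 else 0))
        = (if j \<in> U then of_real \<delta> * (a j * \<omega> j * (walsh_coeff j {j})\<^sup>2) else 0)" for j
      using U by (simp add: if_distrib[of "\<lambda>x. _ * x"] cong: if_cong)
    then have "(\<Sum>j\<in>F. \<Sum>i\<in>U. of_real \<delta> * (a j * \<omega> i * (walsh_coeff j {i})\<^sup>2) * (if j = i then 1 else 0))
        = (\<Sum>j\<in>F. if j \<in> U then of_real \<delta> * (a j * \<omega> j * (walsh_coeff j {j})\<^sup>2) else 0)"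
      by (simp only:)
    also have "\<dots> = (\<Sum>j\<in>U. of_real \<delta> * (a j * \<omega> j * (walsh_coeff j {j})\<^sup>2))"
      using F by (simp add: sum.inter_restrict[symmetric] Int_absorb1)
    finally show ?thesis .
  qed
  also have "\<dots> = of_real (\<delta> * (\<Sum>j\<in>U. cmod (a j) * (cmod (walsh_coeff j {j}))\<^sup>2))"
  proof -
    have "a j * \<omega> j * (walsh_coeff j {j})\<^sup>2 = of_real (cmod (a j) * (cmod (walsh_coeff j {j}))\<^sup>2)" for j
    proof -
      have "\<zeta> * cnj (sgn \<zeta>) = of_real (cmod \<zeta>)" for \<zeta> :: complex
      proof -
        have "\<zeta> * cnj (sgn \<zeta>) = of_real ((cmod \<zeta>)\<^sup>2) / of_real (cmod \<zeta>)"
          unfolding complex_norm_square by (simp add: sgn_eq)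
        then show ?thesis by (simp add: power2_eq_square)
      qed
      from this[of "a j * (walsh_coeff j {j})\<^sup>2"] show ?thesis
        by (simp add: \<omega>_def norm_mult norm_power mult_ac)
    qed
    then show ?thesis by (simp add: sum_distrib_left)
  qed
  finally have eq: "(LINT z|M. f z) = of_real (\<delta> * (\<Sum>j\<in>U. cmod (a j) * (cmod (walsh_coeff j {j}))\<^sup>2))" .
  have "cmod (LINT z|M. f z) \<le> (LINT z|M. cmod (f z))"
    by simp
  also have "\<dots> \<le> (LINT z|M. 4 * N0 + 2 * \<delta>\<^sup>2 * B ^ 5 * (\<Sum>j\<in>F. cmod (a j)))"
  proof (rule integral_mono_AE)
    show "AE z in M. cmod (f z) \<le> 4 * N0 + 2 * \<delta>\<^sup>2 * B ^ 5 * (\<Sum>j\<in>F. cmod (a j))"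
      using AE0 unfolding f_def
      by eventually_elim (intro linear_part_pointwise \<omega> \<delta>)
  qed (use f_int in auto)
  finally show ?thesis
    using \<delta> unfolding eq norm_of_real by (simp add: prob_space abs_of_nonneg sum_nonneg)
qed

end

section \<open>The threefold tensor\<close>

lemma bounded_attained_up_to:
  fixes f :: "'a \<Rightarrow> real"
  assumes "A \<noteq> {}" "0 < \<eta>" "\<And>x. x \<in> A \<Longrightarrow> f x \<le> K"
  obtains x where "x \<in> A" "\<And>y. y \<in> A \<Longrightarrow> f y \<le> f x + \<eta>"
proof -
  have bdd: "bdd_above (f ` A)" using assms(3) by (intro bdd_aboveI2[of A f K])
  have "Sup (f ` A) - \<eta> < Sup (f ` A)" using assms(2) by simp
  then obtain x where x: "x \<in> A" "Sup (f ` A) - \<eta> < f x"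
    using less_cSup_iff[of "f ` A"] bdd assms(1) by auto
  have "f y \<le> f x + \<eta>" if "y \<in> A" for y
    using cSup_upper[of "f y" "f ` A"] bdd that x(2) by auto
  with x(1) show ?thesis by (rule that)
qed

text \<open>Whatever the sign of \<open>C\<close>, the bound \<open>(\<bar>C\<bar> + 1) * sqrt s\<close> lies strictly above the \<open>\<psi>\<^sub>2\<close> norm, so some
  admissible \<open>t\<close> lies below it.\<close>

lemma psi2_condition_imp_integral_bound:
  assumes "psi2_condition C M J \<phi>" "finite F" "F \<subseteq> J" "0 < s" "(\<Sum>j\<in>F. (cmod (a j))\<^sup>2) \<le> s"
  shows "(\<integral>\<^sup>+x. ennreal (exp ((cmod (\<Sum>j\<in>F. a j * \<phi> j x))\<^sup>2 / ((\<bar>C\<bar> + 1)\<^sup>2 * s)) - 1) \<partial>M) \<le> 1"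
proof -
  define f where "f x = (\<Sum>j\<in>F. a j * \<phi> j x)" for x
  have "psi2_norm M f \<le> ennreal (C * sqrt (\<Sum>j\<in>F. (cmod (a j))\<^sup>2))"
    unfolding f_def using assms by (auto simp: psi2_condition_def)
  also have "\<dots> < ennreal ((\<bar>C\<bar> + 1) * sqrt s)"
  proof (rule ennreal_lessI)
    show "0 < (\<bar>C\<bar> + 1) * sqrt s" using assms(4) by (simp add: add_nonneg_pos)
    have "C * sqrt (\<Sum>j\<in>F. (cmod (a j))\<^sup>2) \<le> \<bar>C\<bar> * sqrt s"
      using assms(5) by (intro mult_mono) (auto intro: sum_nonneg)
    also have "\<dots> < (\<bar>C\<bar> + 1) * sqrt s" using assms(4) by simp
    finally show "C * sqrt (\<Sum>j\<in>F. (cmod (a j))\<^sup>2) < (\<bar>C\<bar> + 1) * sqrt s" .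
  qed
  finally obtain t where t: "0 < t" "ennreal t < ennreal ((\<bar>C\<bar> + 1) * sqrt s)"
    and int: "(\<integral>\<^sup>+x. ennreal (exp ((cmod (f x))\<^sup>2 / t\<^sup>2) - 1) \<partial>M) \<le> 1"
    unfolding psi2_norm_def Inf_less_iff by auto
  have "t\<^sup>2 \<le> ((\<bar>C\<bar> + 1) * sqrt s)\<^sup>2"
    using t by (intro power_mono) (auto simp: ennreal_less_iff)
  also have "\<dots> = (\<bar>C\<bar> + 1)\<^sup>2 * s"
    using assms(4) by (simp add: power_mult_distrib)
  finally have "(cmod (f x))\<^sup>2 / ((\<bar>C\<bar> + 1)\<^sup>2 * s) \<le> (cmod (f x))\<^sup>2 / t\<^sup>2" for x
    using t by (intro divide_left_mono mult_pos_pos) (auto simp: assms(4))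
  then have "(\<integral>\<^sup>+x. ennreal (exp ((cmod (f x))\<^sup>2 / ((\<bar>C\<bar> + 1)\<^sup>2 * s)) - 1) \<partial>M)
      \<le> (\<integral>\<^sup>+x. ennreal (exp ((cmod (f x))\<^sup>2 / t\<^sup>2) - 1) \<partial>M)"
    by (intro nn_integral_mono ennreal_leI) simp
  with int show ?thesis by (simp add: f_def)
qed

lemma uniformly_bounded_imp_bound_set:
  assumes "prob_space M" "countable J" "uniformly_bounded_system M J \<phi>"
  obtains B \<Omega>0 where "1 \<le> B" "\<Omega>0 \<in> sets M" "measure M \<Omega>0 = 1"
    "\<And>j x. j \<in> J \<Longrightarrow> x \<in> \<Omega>0 \<Longrightarrow> cmod (\<phi> j x) \<le> B"
proof -
  interpret prob_space M by fact
  define S where "S = (SUP j\<in>J. esssup M (\<lambda>x. ennreal (cmod (\<phi> j x))))"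
  define B where "B = max 1 (enn2real S)"
  have "S < \<infinity>" using assms by (simp add: uniformly_bounded_system_def S_def)
  have "AE x in M. cmod (\<phi> j x) \<le> B" if "j \<in> J" for j
    using esssup_AE[of "\<lambda>x. ennreal (cmod (\<phi> j x))" M]
  proof eventually_elim
    case (elim x)
    also have "esssup M (\<lambda>x. ennreal (cmod (\<phi> j x))) \<le> S"
      unfolding S_def using that by (rule SUP_upper)
    finally have "enn2real (ennreal (cmod (\<phi> j x))) \<le> enn2real S"
      using \<open>S < \<infinity>\<close> by (intro enn2real_mono) auto
    then show ?case by (simp add: B_def)
  qed
  then have "AE x in M. \<forall>j\<in>J. cmod (\<phi> j x) \<le> B"
    using assms(2) by (simp add: AE_ball_countable)
  then obtain N where N: "{x \<in> space M. \<not> (\<forall>j\<in>J. cmod (\<phi> j x) \<le> B)} \<subseteq> N" "emeasure M N = 0" "N \<in> sets M"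
    by (rule AE_E)
  show ?thesis
  proof (rule that[of B "space M - N"])
    show "measure M (space M - N) = 1"
    proof -
      have "prob N = 0" using N(2) by (simp add: measure_def)
      then show ?thesis using prob_compl[OF N(3)] by simp
    qed
  qed (use N in \<open>auto simp: B_def\<close>)
qed

text \<open>With \<open>b\<close> the condensed weights and \<open>P\<close> their total, the lacunary estimate provides points \<open>X S\<close>
  with \<open>(\<Sum>j. b j * \<bar>u j\<bar>) \<ge> t * P\<close>. By convexity \<open>(\<Sum>j. b j * \<bar>u j\<bar>\<^sup>2) \<ge> t\<^sup>2 * P\<close>, and \<open>b j \<le> \<bar>a j\<bar>\<close> lets the duality
  apply with the original coefficients. The largest weight, which condensation does not control, is
  bounded by the supremum through orthonormality.\<close>

theorem threefold_tensor_sidon: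
  fixes M :: "'a measure" and J :: "'i set" and \<phi> :: "'i \<Rightarrow> 'a \<Rightarrow> complex" and C :: real
  assumes M: "prob_space M" and J: "countable J" and on: "orthonormal_system M J \<phi>"
    and ub: "uniformly_bounded_system M J \<phi>" and psi2: "psi2_condition C M J \<phi>"
  obtains \<gamma> :: real where "0 < \<gamma>"
    and "\<And>F a N0. finite F \<Longrightarrow> F \<subseteq> J \<Longrightarrow>
      (\<And>x y z. x \<in> space M \<Longrightarrow> y \<in> space M \<Longrightarrow> z \<in> space M \<Longrightarrow>
        cmod (\<Sum>j\<in>F. a j * (\<phi> j x * \<phi> j y * \<phi> j z)) \<le> N0) \<Longrightarrow>
      \<gamma> * (\<Sum>j\<in>F. cmod (a j)) \<le> N0"
proof -
  interpret prob_space M by (rule M)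
  obtain B \<Omega>0 where B: "1 \<le> B" and \<Omega>0: "\<Omega>0 \<in> sets M" "prob \<Omega>0 = 1"
    and bound: "\<And>j x. j \<in> J \<Longrightarrow> x \<in> \<Omega>0 \<Longrightarrow> cmod (\<phi> j x) \<le> B"
    by (rule uniformly_bounded_imp_bound_set[OF M J ub]) (rule that)
  have meas: "j \<in> J \<Longrightarrow> \<phi> j \<in> borel_measurable M"
    and sq_int: "j \<in> J \<Longrightarrow> integrable M (\<lambda>x. (cmod (\<phi> j x))\<^sup>2)"
    for j
    using on by (auto simp: orthonormal_system_def)
  note sq_one = orthonormal_system_norm[OF on]
  \<comment> \<open>\<open>Re (- \<i> * \<phi>)\<close> is \<open>Im \<phi>\<close>, and one of the two parts of \<open>\<phi>\<close> has at least half of its energy.\<close>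
  define \<theta> where "\<theta> j = (if 1 / 2 \<le> (LINT x|M. (Re (\<phi> j x))\<^sup>2) then 1 else - \<i>)" for j
  define h where "h j x = Re (\<theta> j * \<phi> j x)" for j x
  have \<theta>: "cmod (\<theta> j) = 1" for j by (simp add: \<theta>_def)
  interpret bounded_subgaussian_family M J h "(\<bar>C\<bar> + 1)\<^sup>2" B \<Omega>0
  proof unfold_locales
    show "0 < (\<bar>C\<bar> + 1)\<^sup>2" by (simp add: add_nonneg_pos)
    show "h j \<in> borel_measurable M" if "j \<in> J" for j
      unfolding h_def using meas[OF that]
      by (intro borel_measurable_Re[THEN measurable_compose[rotated]]) auto
    show "\<bar>h i x\<bar> \<le> B" if "i \<in> J" "x \<in> \<Omega>0" for i x
      using abs_Re_le_cmod[of "\<theta> i * \<phi> i x"] bound[OF that] by (simp add: h_def norm_mult \<theta>)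
    show "1 / 2 \<le> (LINT x|M. (h i x)\<^sup>2)" if i: "i \<in> J" for i
    proof (cases "1 / 2 \<le> (LINT x|M. (Re (\<phi> i x))\<^sup>2)")
      case True
      then show ?thesis by (simp add: h_def \<theta>_def)
    next
      case False
      have [measurable]: "\<phi> i \<in> borel_measurable M" by (rule meas[OF i])
      have "integrable M (\<lambda>x. (Re (\<phi> i x))\<^sup>2)" "integrable M (\<lambda>x. (Im (\<phi> i x))\<^sup>2)"
        by (rule Bochner_Integration.integrable_bound[OF sq_int[OF i]]; simp add: cmod_power2)+
      then have "(LINT x|M. (Re (\<phi> i x))\<^sup>2) + (LINT x|M. (Im (\<phi> i x))\<^sup>2) = 1"
        using sq_one[OF i] by (simp add: cmod_power2)
      with False show ?thesis by (simp add: h_def \<theta>_def)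
    qed
    show "(\<integral>\<^sup>+x. ennreal (exp ((\<Sum>j\<in>I. c j * h j x)\<^sup>2 / ((\<bar>C\<bar> + 1)\<^sup>2 * s))) \<partial>M) \<le> 2"
      if I: "finite I" "I \<subseteq> J" and s: "0 < s" "(\<Sum>j\<in>I. (c j)\<^sup>2) \<le> s" for I c and s :: real
    proof -
      define a where "a j = of_real (c j) * \<theta> j" for j
      define E where "E x = exp ((cmod (\<Sum>j\<in>I. a j * \<phi> j x))\<^sup>2 / ((\<bar>C\<bar> + 1)\<^sup>2 * s))" for x
      have [measurable]: "(\<lambda>x. \<Sum>j\<in>I. a j * \<phi> j x) \<in> borel_measurable M"
        by (intro borel_measurable_sum borel_measurable_times borel_measurable_const meas)
           (use I in auto)
      have [measurable]: "E \<in> borel_measurable M"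
        unfolding E_def by measurable
      have E1: "1 \<le> E x" for x unfolding E_def using s by simp
      have "(\<integral>\<^sup>+x. ennreal (exp ((\<Sum>j\<in>I. c j * h j x)\<^sup>2 / ((\<bar>C\<bar> + 1)\<^sup>2 * s))) \<partial>M)
          \<le> (\<integral>\<^sup>+x. ennreal (E x - 1) + 1 \<partial>M)"
      proof (intro nn_integral_mono)
        fix x
        have "(\<Sum>j\<in>I. c j * h j x) = Re (\<Sum>j\<in>I. a j * \<phi> j x)"
          by (simp add: h_def a_def mult.assoc)
        then have "(\<Sum>j\<in>I. c j * h j x)\<^sup>2 \<le> (cmod (\<Sum>j\<in>I. a j * \<phi> j x))\<^sup>2"
          using abs_Re_le_cmod[of "\<Sum>j\<in>I. a j * \<phi> j x"] by (metis abs_le_square_iff abs_norm_cancel)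
        then have "exp ((\<Sum>j\<in>I. c j * h j x)\<^sup>2 / ((\<bar>C\<bar> + 1)\<^sup>2 * s)) \<le> E x"
          unfolding E_def using s by (simp add: divide_right_mono)
        then show "ennreal (exp ((\<Sum>j\<in>I. c j * h j x)\<^sup>2 / ((\<bar>C\<bar> + 1)\<^sup>2 * s))) \<le> ennreal (E x - 1) + 1"
          using E1[of x] by (simp add: ennreal_leI flip: ennreal_1 ennreal_plus)
      qed
      also have "\<dots> = (\<integral>\<^sup>+x. ennreal (E x - 1) \<partial>M) + 1"
        by (subst nn_integral_add) (auto simp: emeasure_space_1)
      also have "\<dots> \<le> 1 + 1"
      proof (intro add_mono order_refl)
        show "(\<integral>\<^sup>+x. ennreal (E x - 1) \<partial>M) \<le> 1"
          unfolding E_def using s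
          by (intro psi2_condition_imp_integral_bound[OF psi2 I s(1)]) (simp add: a_def norm_mult \<theta>)
      qed
      finally show ?thesis by simp
    qed
  qed (use B \<Omega>0 in auto)
  show ?thesis
  proof (rule lacunary_rademacher_sidon)
    fix c :: real and N L :: nat
    assume c: "0 < c" and N: "0 < N" and L: "2 \<le> L"
      and rs: "\<And>(d :: nat) I b g.
        (\<And>k. k < d \<Longrightarrow> finite (I k) \<and> I k \<subseteq> J \<and> N \<le> card (I k) \<and> (0::real) \<le> b k) \<Longrightarrow>
        (\<And>k l. k < d \<Longrightarrow> l < d \<Longrightarrow> k \<noteq> l \<Longrightarrow> I k \<inter> I l = {}) \<Longrightarrow>
        (\<And>k. Suc k < d \<Longrightarrow> L * card (I k) \<le> card (I (Suc k))) \<Longrightarrow>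
        (\<And>S x. S \<subseteq> (\<Union>k<d. I k) \<Longrightarrow> x \<in> \<Omega>0 \<Longrightarrow> (\<Sum>k<d. b k * rsum (I k) S x) \<le> g S) \<Longrightarrow>
        c * (\<Sum>k<d. b k * card (I k)) \<le> cube_mean (\<Union>k<d. I k) g"
    define t where "t = min (c / 2) 1"
    \<comment> \<open>With this value the quadratic error of the duality is half of what condensation gives.\<close>
    define \<delta> where "\<delta> = t\<^sup>2 / (4 * L * B ^ 5)"
    have t: "0 < t" "t \<le> 1" "t \<le> c / 2" using c by (simp_all add: t_def)
    have B5: "1 \<le> B ^ 5" using B by simp
    have \<delta>: "0 < \<delta>" using t L B by (simp add: \<delta>_def)
    have \<delta>B: "\<delta> * B \<le> 1"
    proof -
      have "t\<^sup>2 * B \<le> 1 * B ^ 5"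
        using t B power_increasing[of 1 5 B] by (intro mult_mono) (auto simp: power_le_one)
      also have "\<dots> \<le> 4 * L * B ^ 5" using L B B5 by (intro mult_right_mono) auto
      finally show ?thesis using L B by (simp add: \<delta>_def divide_le_eq)
    qed
    define m where "m = 4 + t\<^sup>2 * \<delta> * N"
    define \<gamma> where "\<gamma> = \<delta> * t\<^sup>2 / (2 * L) / m"
    have m: "0 < m"
      using \<delta> unfolding m_def by (intro add_pos_nonneg) auto
    show ?thesis
    proof (rule that[of \<gamma>])
      show "0 < \<gamma>" using t \<delta> L m by (simp add: \<gamma>_def)
    next
      fix F and a :: "'i \<Rightarrow> complex" and N0 :: real
      assume F: "finite F" "F \<subseteq> J"
        and N0: "\<And>x y z. x \<in> space M \<Longrightarrow> y \<in> space M \<Longrightarrow> z \<in> space M \<Longrightarrow>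
          cmod (\<Sum>j\<in>F. a j * (\<phi> j x * \<phi> j y * \<phi> j z)) \<le> N0"
      obtain x0 where "x0 \<in> space M" using not_empty by blast
      then have N0_nonneg: "0 \<le> N0" using N0 by (meson norm_ge_zero order_trans)
      define A where "A = (\<Sum>j\<in>F. cmod (a j))"
      have onF: "orthonormal_system M F \<phi>"
        using on F unfolding orthonormal_system_def by blast
      have single: "cmod (a j) \<le> N0" if j: "j \<in> F" for j
      proof -
        have "cmod (a j) * (cmod (\<phi> j x))\<^sup>2 \<le> N0" if x: "x \<in> space M" for x
        proof -
          have "cmod (a j * (\<phi> j x)\<^sup>2) \<le> N0"
            by (rule orthonormal_coefficient_le_sup[OF M onF F(1) j, of "\<lambda>j. a j * (\<phi> j x)\<^sup>2"])
               (use N0[OF x x] in \<open>simp add: power2_eq_square mult.assoc\<close>)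
          then show ?thesis by (simp add: norm_mult norm_power)
        qed
        then have "(LINT x|M. cmod (a j) * (cmod (\<phi> j x))\<^sup>2) \<le> (LINT x|M. N0)"
          using sq_int j F by (intro integral_mono) auto
        then have "cmod (a j) * (LINT x|M. (cmod (\<phi> j x))\<^sup>2) \<le> N0"
          by (simp add: prob_space)
        then show ?thesis
          using sq_one[of j] j F by auto
      qed
      obtain d :: nat and I and b :: "nat \<Rightarrow> real"
        where blocks: "\<And>k. k < d \<Longrightarrow> finite (I k) \<and> I k \<subseteq> F \<and> N \<le> card (I k) \<and> 0 \<le> b k"
        and b_le: "\<And>k j. k < d \<Longrightarrow> j \<in> I k \<Longrightarrow> b k \<le> cmod (a j)"
        and disj: "\<And>k l. k < d \<Longrightarrow> l < d \<Longrightarrow> k \<noteq> l \<Longrightarrow> I k \<inter> I l = {}"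
        and lac: "\<And>k. Suc k < d \<Longrightarrow> L * card (I k) \<le> card (I (Suc k))"
        and cond: "(\<Sum>j\<in>F. cmod (a j)) \<le> N * L * N0 + L * (\<Sum>k<d. b k * card (I k))"
        by (rule lacunary_blocks[of F "\<lambda>j. cmod (a j)" N0 N L, OF F(1) norm_ge_zero single N0_nonneg N L])
           (assumption, rule that)
      define P where "P = (\<Sum>k<d. b k * card (I k))"
      define U where "U = (\<Union>k<d. I k)"
      define f where "f S x = (\<Sum>k<d. b k * rsum (I k) S x)" for S x
      have U: "finite U" "U \<subseteq> F" using blocks by (auto simp: U_def)
      have P: "0 \<le> P" unfolding P_def using blocks by (intro sum_nonneg) auto
      have main: "\<delta> * (t\<^sup>2 * P) \<le> 4 * N0 + 2 * \<delta>\<^sup>2 * B ^ 5 * A"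
      proof (cases "P = 0")
        case True
        then show ?thesis using N0_nonneg B by (simp add: A_def sum_nonneg)
      next
        case False
        define \<eta> where "\<eta> = c * P / 2"
        have \<eta>: "0 < \<eta>" using False P c by (simp add: \<eta>_def)
        have "\<exists>x\<in>\<Omega>0. \<forall>y\<in>\<Omega>0. f S y \<le> f S x + \<eta>" for S
        proof -
          have "\<Omega>0 \<noteq> {}" using \<Omega>0 by auto
          moreover have "f S x \<le> (\<Sum>k<d. b k * (\<Sum>i\<in>I k. B))" if x: "x \<in> \<Omega>0" for x
            unfolding f_def rsum_def
          proof (intro sum_mono mult_left_mono)
            fix k i assume "k \<in> {..<d}" "i \<in> I k"
            then have "\<bar>sgn_at S i * h i x\<bar> \<le> B"
              using h_bound[of i x] x blocks[of k] F by (auto simp: abs_mult)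
            then show "sgn_at S i * h i x \<le> B" by linarith
          qed (use blocks in auto)
          ultimately obtain x where "x \<in> \<Omega>0" "\<And>y. y \<in> \<Omega>0 \<Longrightarrow> f S y \<le> f S x + \<eta>"
            using bounded_attained_up_to[of \<Omega>0 \<eta> "f S"] \<eta> by blast
          then show ?thesis by blast
        qed
        then have ex: "\<forall>S. \<exists>x. x \<in> \<Omega>0 \<and> (\<forall>y\<in>\<Omega>0. f S y \<le> f S x + \<eta>)" by blast
        obtain X where X: "\<And>S. X S \<in> \<Omega>0" and X_max: "\<And>S y. y \<in> \<Omega>0 \<Longrightarrow> f S y \<le> f S (X S) + \<eta>"
          using choice[OF ex] by blast
        interpret riesz_duality M F U \<phi> a X \<Omega>0 B N0
          by unfold_locales (use F U onF \<Omega>0 B bound X N0 in auto)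
        have "c * P \<le> cube_mean U (\<lambda>S. f S (X S) + \<eta>)"
          unfolding P_def U_def
        proof (rule rs)
          show "finite (I k) \<and> I k \<subseteq> J \<and> N \<le> card (I k) \<and> 0 \<le> b k" if "k < d" for k
            using blocks[OF that] \<open>F \<subseteq> J\<close> by auto
          show "(\<Sum>k<d. b k * rsum (I k) S x) \<le> f S (X S) + \<eta>" if "x \<in> \<Omega>0" for S x
            using X_max[OF that] by (simp add: f_def)
        qed (use disj lac in auto)
        then have "c * P / 2 \<le> cube_mean U (\<lambda>S. f S (X S))"
          using U by (simp add: cube_mean_add \<eta>_def)
        also have "\<dots> = (\<Sum>k<d. b k * (\<Sum>j\<in>I k. cube_mean U (\<lambda>S. sgn_at S j * h j (X S))))"
          unfolding f_def rsum_def by (simp add: cube_mean_sum cube_mean_cmult)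
        also have "\<dots> \<le> (\<Sum>k<d. b k * (\<Sum>j\<in>I k. cmod (walsh_coeff j {j})))"
        proof (intro sum_mono mult_left_mono)
          fix k j
          have "cube_mean U (\<lambda>S. sgn_at S j * h j (X S)) = Re (\<theta> j * walsh_coeff j {j})"
          proof -
            have "\<theta> j * walsh_coeff j {j} = cube_mean U (\<lambda>S. of_real (sgn_at S j) * (\<theta> j * \<phi> j (X S)))"
              unfolding walsh_coeff_def walsh_def cube_mean_cmult[symmetric] by (simp add: mult_ac)
            also have "Re \<dots> = cube_mean U (\<lambda>S. Re (of_real (sgn_at S j) * (\<theta> j * \<phi> j (X S))))"
              by (rule Re_cube_mean)
            finally show ?thesis by (simp add: h_def)
          qed
          also have "\<dots> \<le> cmod (walsh_coeff j {j})"
            using complex_Re_le_cmod[of "\<theta> j * walsh_coeff j {j}"] by (simp add: norm_mult \<theta>)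
          finally show "cube_mean U (\<lambda>S. sgn_at S j * h j (X S)) \<le> cmod (walsh_coeff j {j})" .
        qed (use blocks in auto)
        finally have u: "c / 2 * P \<le> (\<Sum>k<d. b k * (\<Sum>j\<in>I k. cmod (walsh_coeff j {j})))" by simp
        have "t * P \<le> c / 2 * P" using t P by (intro mult_right_mono) auto
        with u have "2 * t * (t * P) \<le> 2 * t * (\<Sum>k<d. b k * (\<Sum>j\<in>I k. cmod (walsh_coeff j {j})))"
          using t by (intro mult_left_mono) auto
        then have "t\<^sup>2 * P \<le> 2 * t * (\<Sum>k<d. b k * (\<Sum>j\<in>I k. cmod (walsh_coeff j {j}))) - t\<^sup>2 * P"
          by (simp add: power2_eq_square algebra_simps)
        also have "\<dots> = (\<Sum>k<d. b k * (\<Sum>j\<in>I k. 2 * t * cmod (walsh_coeff j {j}) - t\<^sup>2))"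
          by (simp add: P_def sum_distrib_left sum_subtractf right_diff_distrib mult_ac)
        also have "\<dots> \<le> (\<Sum>k<d. \<Sum>j\<in>I k. cmod (a j) * (cmod (walsh_coeff j {j}))\<^sup>2)"
          unfolding sum_distrib_left
        proof (intro sum_mono)
          fix k j assume k: "k \<in> {..<d}" and j: "j \<in> I k"
          have "0 \<le> (cmod (walsh_coeff j {j}) - t)\<^sup>2" by simp
          then have "2 * t * cmod (walsh_coeff j {j}) - t\<^sup>2 \<le> (cmod (walsh_coeff j {j}))\<^sup>2"
            by (simp add: power2_eq_square algebra_simps)
          then have "b k * (2 * t * cmod (walsh_coeff j {j}) - t\<^sup>2) \<le> b k * (cmod (walsh_coeff j {j}))\<^sup>2"
            using blocks k by (intro mult_left_mono) auto
          also have "\<dots> \<le> cmod (a j) * (cmod (walsh_coeff j {j}))\<^sup>2"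
            using b_le k j by (intro mult_right_mono) auto
          finally show "b k * (2 * t * cmod (walsh_coeff j {j}) - t\<^sup>2) \<le> cmod (a j) * (cmod (walsh_coeff j {j}))\<^sup>2" .
        qed
        also have "\<dots> = (\<Sum>j\<in>U. cmod (a j) * (cmod (walsh_coeff j {j}))\<^sup>2)"
          unfolding U_def using blocks disj by (intro sum.UNION_disjoint[symmetric]) auto
        finally have "\<delta> * (t\<^sup>2 * P) \<le> \<delta> * (\<Sum>j\<in>U. cmod (a j) * (cmod (walsh_coeff j {j}))\<^sup>2)"
          using \<delta> by (intro mult_left_mono) auto
        also have "\<dots> \<le> 4 * N0 + 2 * \<delta>\<^sup>2 * B ^ 5 * A"
          unfolding A_def using \<delta> \<delta>B by (intro diagonal_coefficients) auto
        finally show ?thesis .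
      qed
      have "2 * \<delta>\<^sup>2 * B ^ 5 * A = \<delta> * A * (2 * \<delta> * B ^ 5)"
        by (simp add: power2_eq_square)
      also have "2 * \<delta> * B ^ 5 = t\<^sup>2 / (2 * L)"
        using B by (simp add: \<delta>_def)
      finally have "2 * \<delta>\<^sup>2 * B ^ 5 * A = \<delta> * t\<^sup>2 * A / (2 * L)" by simp
      moreover have "\<delta> * t\<^sup>2 * (A / L) \<le> \<delta> * t\<^sup>2 * (N * N0 + P)"
      proof (intro mult_left_mono)
        show "A / L \<le> N * N0 + P"
          using cond[folded A_def] L by (simp add: P_def field_simps)
      qed (use \<delta> in auto)
      ultimately have "\<delta> * t\<^sup>2 * A / (2 * L) \<le> N0 * m"
        using main by (simp add: m_def algebra_simps)
      then have "\<delta> * t\<^sup>2 * A / (2 * L) / m \<le> N0"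
        using m by (simp only: pos_divide_le_eq)
      then show "\<gamma> * (\<Sum>j\<in>F. cmod (a j)) \<le> N0"
        by (simp add: \<gamma>_def A_def)
    qed
  qed
qed

section \<open>The fivefold tensor\<close>

lemma tensor_power_measurable:
  assumes f: "f \<in> borel_measurable M"
  shows "tensor_power n f \<in> borel_measurable (power_measure n M)"
proof -
  have "(\<lambda>x. f (x s)) \<in> borel_measurable (Pi\<^sub>M {1..n} (\<lambda>_. M))" if "s \<in> {1..n}" for s
    using measurable_component_singleton[OF that, of "\<lambda>_. M"] f by (rule measurable_compose)
  then have "(\<lambda>x. \<Prod>s=1..n. f (x s)) \<in> borel_measurable (Pi\<^sub>M {1..n} (\<lambda>_. M))"
    by (rule borel_measurable_prod)
  then show ?thesis
    unfolding tensor_power_def[abs_def] power_measure_def .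
qed

lemma orthonormal_system_tensor_power:
  assumes M: "prob_space M" and on: "orthonormal_system M J \<phi>" and n: "0 < n"
  shows "orthonormal_system (power_measure n M) J (\<lambda>j. tensor_power n (\<phi> j))"
proof -
  interpret prob_space M by (rule M)
  interpret P: product_prob_space "\<lambda>_. M" "{1..n}" by unfold_locales
  have meas: "j \<in> J \<Longrightarrow> \<phi> j \<in> borel_measurable M"
    and sq_int: "j \<in> J \<Longrightarrow> integrable M (\<lambda>x. (cmod (\<phi> j x))\<^sup>2)" for j
    using on by (auto simp: orthonormal_system_def)
  show ?thesis
    unfolding orthonormal_system_def
  proof (intro conjI ballI)
    fix j assume j: "j \<in> J"
    show "tensor_power n (\<phi> j) \<in> borel_measurable (power_measure n M)"
      by (rule tensor_power_measurable[OF meas[OF j]])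
    have "integrable (Pi\<^sub>M {1..n} (\<lambda>_. M)) (\<lambda>x. \<Prod>s=1..n. (cmod (\<phi> j (x s)))\<^sup>2)"
      by (rule P.product_integrable_prod) (auto intro: sq_int[OF j])
    then show "integrable (power_measure n M) (\<lambda>x. (cmod (tensor_power n (\<phi> j) x))\<^sup>2)"
      by (simp add: tensor_power_def power_measure_def prod_power_distrib flip: prod_norm)
  next
    fix i j assume ij: "i \<in> J" "j \<in> J"
    have "(LINT x|power_measure n M. tensor_power n (\<phi> i) x * cnj (tensor_power n (\<phi> j) x))
        = (LINT x|Pi\<^sub>M {1..n} (\<lambda>_. M). (\<Prod>s=1..n. \<phi> i (x s) * cnj (\<phi> j (x s))))"
      by (simp add: tensor_power_def power_measure_def prod.distrib)
    also have "\<dots> = (\<Prod>s=1..n. LINT x|M. \<phi> i x * cnj (\<phi> j x))"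
      by (rule P.product_integral_prod) (auto intro: orthonormal_system_integrable[OF on ij])
    also have "\<dots> = (if i = j then 1 else 0)"
      using on ij n by (simp add: orthonormal_system_def)
    finally show "(LINT x|power_measure n M. tensor_power n (\<phi> i) x * cnj (tensor_power n (\<phi> j) x))
        = (if i = j then 1 else 0)" .
  qed
qed

lemma uniformly_bounded_system_tensor_power:
  assumes M: "prob_space M" and meas: "\<And>j. j \<in> J \<Longrightarrow> \<phi> j \<in> borel_measurable M"
    and bound: "\<And>j. j \<in> J \<Longrightarrow> AE x in M. cmod (\<phi> j x) \<le> B"
  shows "uniformly_bounded_system (power_measure n M) J (\<lambda>j. tensor_power n (\<phi> j))"
proof -
  have "(SUP j\<in>J. esssup (power_measure n M) (\<lambda>x. ennreal (cmod (tensor_power n (\<phi> j) x)))) \<le> ennreal (B ^ n)"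
  proof (rule SUP_least)
    fix j assume j: "j \<in> J"
    have m: "tensor_power n (\<phi> j) \<in> borel_measurable (power_measure n M)"
      by (rule tensor_power_measurable[OF meas[OF j]])
    have "AE x in power_measure n M. \<forall>s\<in>{1..n}. cmod (\<phi> j (x s)) \<le> B"
      unfolding power_measure_def
      by (intro AE_finite_allI AE_PiM_component M bound[OF j]) auto
    then have "AE x in power_measure n M. ennreal (cmod (tensor_power n (\<phi> j) x)) \<le> ennreal (B ^ n)"
    proof eventually_elim
      case (elim x)
      have "cmod (tensor_power n (\<phi> j) x) \<le> (\<Prod>s=1..n. B)"
        unfolding tensor_power_def prod_norm[symmetric]
        using elim by (intro prod_mono) auto
      then show ?case by (simp add: ennreal_leI)
    qed
    then show "esssup (power_measure n M) (\<lambda>x. ennreal (cmod (tensor_power n (\<phi> j) x))) \<le> ennreal (B ^ n)"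
      using m by (intro esssup_I) auto
  qed
  then show ?thesis
    unfolding uniformly_bounded_system_def by (rule le_less_trans) simp
qed

text \<open>\<^const>\<open>sidon_system\<close> also asks for orthonormality and uniform boundedness of the tensor powers,
  which follow from Fubini's theorem and from the bounds in each coordinate. If the supremum is
  infinite there is nothing to prove; otherwise the fourth and the fifth coordinate are set to the same \<open>p\<close>.\<close>

theorem theorem3:
  fixes M :: "'a measure" and J :: "'i set" and \<phi> :: "'i \<Rightarrow> 'a \<Rightarrow> complex" and C :: real
  assumes "prob_space M"
    and "countable J"
    and "orthonormal_system M J \<phi>"
    and "uniformly_bounded_system M J \<phi>"
    and "psi2_condition C M J \<phi>"
  shows "sidon_system (power_measure 5 M) J (\<lambda>j. tensor_power 5 (\<phi> j))"
proof -
  interpret prob_space M by fact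
  obtain \<gamma> :: real where "0 < \<gamma>"
    and three: "\<And>F a N0. finite F \<Longrightarrow> F \<subseteq> J \<Longrightarrow>
      (\<And>x y z. x \<in> space M \<Longrightarrow> y \<in> space M \<Longrightarrow> z \<in> space M \<Longrightarrow>
        cmod (\<Sum>j\<in>F. a j * (\<phi> j x * \<phi> j y * \<phi> j z)) \<le> N0) \<Longrightarrow>
      \<gamma> * (\<Sum>j\<in>F. cmod (a j)) \<le> N0"
    using threefold_tensor_sidon[OF assms] by blast
  have "ennreal (\<gamma> * (\<Sum>j\<in>F. cmod (a j)))
      \<le> (SUP x\<in>space (power_measure 5 M). ennreal (cmod (\<Sum>j\<in>F. a j * tensor_power 5 (\<phi> j) x)))"
    (is "_ \<le> ?S") if F: "finite F" "F \<subseteq> J" for F and a :: "'i \<Rightarrow> complex"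
  proof (cases "?S = \<infinity>")
    case False
    then obtain K where K: "0 \<le> K" "?S = ennreal K"
      by (cases ?S) auto
    have five: "cmod (\<Sum>j\<in>F. a j * (\<phi> j p)\<^sup>2 * (\<phi> j x * \<phi> j y * \<phi> j z)) \<le> K"
      if "p \<in> space M" "x \<in> space M" "y \<in> space M" "z \<in> space M" for p x y z
    proof -
      define \<xi> where "\<xi> = restrict (\<lambda>s. if s = 1 then x else if s = 2 then y else if s = 3 then z else p) {1..5::nat}"
      have five_set: "{1..5::nat} = {1, 2, 3, 4, 5}" by auto
      have "\<xi> \<in> space (power_measure 5 M)"
        using that by (auto simp: power_measure_def space_PiM \<xi>_def)
      then have "ennreal (cmod (\<Sum>j\<in>F. a j * tensor_power 5 (\<phi> j) \<xi>)) \<le> ennreal K"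
        unfolding K(2)[symmetric] by (rule SUP_upper)
      moreover have "tensor_power 5 (\<phi> j) \<xi> = (\<phi> j p)\<^sup>2 * (\<phi> j x * \<phi> j y * \<phi> j z)" for j
        unfolding tensor_power_def five_set by (simp add: \<xi>_def power2_eq_square mult_ac)
      ultimately show ?thesis
        using K(1) by (simp add: mult.assoc)
    qed
    have "\<gamma> * (\<Sum>j\<in>F. cmod (a j) * (cmod (\<phi> j p))\<^sup>2) \<le> K" if "p \<in> space M" for p
      using three[OF F, of "\<lambda>j. a j * (\<phi> j p)\<^sup>2" K] five[OF that]
      by (simp add: norm_mult norm_power)
    moreover have sq: "integrable M (\<lambda>p. (cmod (\<phi> j p))\<^sup>2)" "(LINT p|M. (cmod (\<phi> j p))\<^sup>2) = 1" if "j \<in> F" for j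
      using assms(3) F that orthonormal_system_norm[OF assms(3)] by (auto simp: orthonormal_system_def)
    ultimately have "(LINT p|M. \<gamma> * (\<Sum>j\<in>F. cmod (a j) * (cmod (\<phi> j p))\<^sup>2)) \<le> (LINT p|M. K)"
      by (intro integral_mono) auto
    then have "\<gamma> * (\<Sum>j\<in>F. cmod (a j)) \<le> K"
      by (simp add: sq prob_space)
    then show ?thesis
      unfolding K(2) by (rule ennreal_leI)
  qed (simp only: infinity_ennreal_def top_greatest)
  moreover obtain B \<Omega>0 where \<Omega>0: "\<Omega>0 \<in> sets M" "prob \<Omega>0 = 1"
    and bound: "\<And>j x. j \<in> J \<Longrightarrow> x \<in> \<Omega>0 \<Longrightarrow> cmod (\<phi> j x) \<le> B"
    using uniformly_bounded_imp_bound_set[OF assms(1,2,4)] by metis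
  have "AE x in M. x \<in> \<Omega>0"
    using prob_eq_1[OF \<Omega>0(1)] \<Omega>0(2) by simp
  then have "uniformly_bounded_system (power_measure 5 M) J (\<lambda>j. tensor_power 5 (\<phi> j))"
    using assms(3) bound
    by (intro uniformly_bounded_system_tensor_power[OF assms(1), of J \<phi> B])
       (auto simp: orthonormal_system_def elim!: eventually_mono)
  moreover have "orthonormal_system (power_measure 5 M) J (\<lambda>j. tensor_power 5 (\<phi> j))"
    by (rule orthonormal_system_tensor_power[OF assms(1,3)]) simp
  ultimately show ?thesis
    unfolding sidon_system_def using \<open>0 < \<gamma>\<close> by blast
qed

end
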